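(* Let $E\subset\mathbb{R}^d$ be a non-empty compact set and let $m$ be an integer with $0<m<d$. Then $$\underline{\dim}_B P_V(E)=m\ \text{ for }\gamma_{d,m}\text{-almost all }V\in G(d,m)\iff m\le\underline{\dim}_{qH}E,$$ and $$\overline{\dim}_B P_V(E)=m\ \text{ for }\gamma_{d,m}\text{-almost all }V\in G(d,m)\iff m\le\overline{\dim}_{qH}E.$$
   Context: $\underline{\dim}_B$ and $\overline{\dim}_B$ denote the lower and upper box dimensions. $G(d,m)$ is the Grassmannian of all $m$-dimensional linear subspaces of $\mathbb{R}^d$, $\gamma_{d,m}$ is the Haar (rotation-invariant probability) measure on $G(d,m)$, and $P_V$ is the orthogonal projection of $\mathbb{R}^d$ onto $V$. $|U|$ denotes the diameter of a set $U$. Intermediate dimensions. For a non-empty bounded set $F\subset\mathbb{R}^d$ and $\theta\in(0,1]$, the lower $\theta$-intermediate dimension $\underline{\dim}_\theta F$ is the infimum of all $s\ge 0$ such that for all $\epsilon>0$ and all $\delta_0>0$ there exist $0<\delta\le\delta_0$ and a cover $\{U_i\}_{i\in I}$ of $F$ with $\delta^{1/\theta}\le|U_i|\le\delta$ for all $i$ and $\sum_{i}|U_i|^s\le\epsilon$. The upper $\theta$-intermediate dimension $\overline{\dim}_\theta F$ is the infimum of all $s\ge 0$ such that for all $\epsilon>0$ there exists $\delta_0>0$ such that for all $0<\delta\le\delta_0$ there is a cover $\{U_i\}_{i\in I}$ of $F$ with $\delta^{1/\theta}\le|U_i|\le\delta$ for all $i$ and $\sum_i|U_i|^s\le\epsilon$.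 Quasi-Hausdorff dimensions. $\underline{\dim}_{qH}F:=\lim_{\theta\to0^+}\underline{\dim}_\theta F$ and $\overline{\dim}_{qH}F:=\lim_{\theta\to0^+}\overline{\dim}_\theta F$. *)

theory Defs
  imports "HOL-Probability.Probability"
begin

text \<open>
  Diameters are only measured on bounded sets: \<^const>\<open>diameter\<close> is a real supremum, hence
  meaningless on unbounded ones.
\<close>

definition covering_number :: "'a::euclidean_space set \<Rightarrow> real \<Rightarrow> nat" where
  "covering_number F \<delta> =
     (LEAST n. \<exists>\<U>. finite \<U> \<and> card \<U> = n \<and> F \<subseteq> \<Union>\<U> \<and>
                   (\<forall>U\<in>\<U>. bounded U \<and> diameter U \<le> \<delta>))"

definition lower_box_dim :: "'a::euclidean_space set \<Rightarrow> ereal" where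
  "lower_box_dim F =
     Liminf (at_right 0) (\<lambda>\<delta>. ereal (ln (real (covering_number F \<delta>)) / - ln \<delta>))"

definition upper_box_dim :: "'a::euclidean_space set \<Rightarrow> ereal" where
  "upper_box_dim F =
     Limsup (at_right 0) (\<lambda>\<delta>. ereal (ln (real (covering_number F \<delta>)) / - ln \<delta>))"

text \<open>
  The sum over the cover is taken in the extended nonnegative reals, so that it is a genuine
  sum for covers of any cardinality.
\<close>

definition intermediate_cover ::
  "real \<Rightarrow> real \<Rightarrow> real \<Rightarrow> real \<Rightarrow> 'a::euclidean_space set \<Rightarrow> 'a set set \<Rightarrow> bool" where
  "intermediate_cover \<theta> s \<epsilon> \<delta> F \<U> \<longleftrightarrow>
     F \<subseteq> \<Union>\<U> \<and>
     (\<forall>U\<in>\<U>. bounded U \<and> \<delta> powr (1 / \<theta>) \<le> diameter U \<and> diameter U \<le> \<delta>) \<and>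
     (\<Sum>\<^sub>\<infinity>U\<in>\<U>. ennreal (diameter U powr s)) \<le> ennreal \<epsilon>"

definition lower_intermediate_dim :: "real \<Rightarrow> 'a::euclidean_space set \<Rightarrow> ereal" where
  "lower_intermediate_dim \<theta> F =
     Inf {ereal s | s. 0 \<le> s \<and>
       (\<forall>\<epsilon>>0. \<forall>\<delta>\<^sub>0>0. \<exists>\<delta>. 0 < \<delta> \<and> \<delta> \<le> \<delta>\<^sub>0 \<and> (\<exists>\<U>. intermediate_cover \<theta> s \<epsilon> \<delta> F \<U>))}"

definition upper_intermediate_dim :: "real \<Rightarrow> 'a::euclidean_space set \<Rightarrow> ereal" where
  "upper_intermediate_dim \<theta> F =
     Inf {ereal s | s. 0 \<le> s \<and>
       (\<forall>\<epsilon>>0. \<exists>\<delta>\<^sub>0>0. \<forall>\<delta>. 0 < \<delta> \<and> \<delta> \<le> \<delta>\<^sub>0 \<longrightarrow> (\<exists>\<U>. intermediate_cover \<theta> s \<epsilon> \<delta> F \<U>))}"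

definition lower_qH_dim :: "'a::euclidean_space set \<Rightarrow> ereal" where
  "lower_qH_dim F = Lim (at_right 0) (\<lambda>\<theta>. lower_intermediate_dim \<theta> F)"

definition upper_qH_dim :: "'a::euclidean_space set \<Rightarrow> ereal" where
  "upper_qH_dim F = Lim (at_right 0) (\<lambda>\<theta>. upper_intermediate_dim \<theta> F)"

definition orth_proj :: "'a::euclidean_space set \<Rightarrow> 'a \<Rightarrow> 'a" where
  "orth_proj V x = (THE y. y \<in> V \<and> (\<forall>v\<in>V. orthogonal (x - y) v))"

definition grassmannian :: "nat \<Rightarrow> (real ^ 'd) set set" where
  "grassmannian m = {V. subspace V \<and> dim V = m}"

text \<open>
  The usual topology on the Grassmannian is that of the metric given by the norm of the
  difference of the orthogonal projections. Its Borel sets are the preimages of Borel sets of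
  matrices under the map that sends a subspace to its projection matrix.
\<close>

definition grassmannian_borel :: "nat \<Rightarrow> (real ^ 'd) set measure" where
  "grassmannian_borel m = vimage_algebra (grassmannian m) (\<lambda>V. matrix (orth_proj V)) borel"

text \<open>
  This determines the measure uniquely, since the orthogonal group is compact and acts
  transitively on the Grassmannian.
\<close>

definition grassmannian_haar :: "nat \<Rightarrow> (real ^ 'd) set measure \<Rightarrow> bool" where
  "grassmannian_haar m \<gamma> \<longleftrightarrow>
     prob_space \<gamma> \<and> sets \<gamma> = sets (grassmannian_borel m) \<and>
     (\<forall>g A. orthogonal_transformation g \<and> A \<in> sets \<gamma> \<longrightarrow>
        emeasure \<gamma> ((\<lambda>V. g ` V) ` A) = emeasure \<gamma> A)"

end

theory Submission
  imports Defs
begin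

text \<open>
  Both equivalences come from comparing, at each small scale \<open>r = \<delta> powr (1 / \<theta>)\<close>, economical
  covers of \<open>E\<close> by sets with diameters in \<open>[r, \<delta>]\<close> with the number of sets of diameter at
  most \<open>r\<close> needed to cover a projection of \<open>E\<close>. Since \<open>\<theta>\<close>-intermediate dimensions increase with \<open>\<theta>\<close>,
  the quasi-Hausdorff dimensions are infima over \<open>\<theta>\<close> in \<open>(0, 1]\<close>, and the condition
  \<open>m \<le> dim\<^sub>q\<^sub>H E\<close> says that every \<open>\<theta>\<close>-intermediate dimension is at least \<open>m\<close>.

  If some \<open>\<theta>\<close>-intermediate dimension is below \<open>m\<close>, take a cover with
  \<open>\<Sum> |U| powr s \<le> 1\<close> for some \<open>s < m\<close>. The projection of \<open>U\<close> to an \<open>m\<close>-dimensional \<open>V\<close> splits into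
  at most \<open>C * (|U| / r) ^ m\<close> cells of diameter at most \<open>r\<close>, so the whole projection needs only
  \<open>C * r powr - (m - \<theta> * (m - s))\<close> of them (\<open>covering_number_projection_le\<close>). The box dimension
  of the projection then drops below \<open>m\<close>, and it does so for every \<open>V\<close>, not only for
  almost every one.

  Conversely, fix \<open>s < m\<close> and suppose that at scale \<open>r\<close> no economical cover exists. A discrete form of
  Frostman's lemma (\<open>discrete_frostman\<close>) turns this into a finitely supported probability measure
  on \<open>E\<close> whose balls of radius \<open>\<rho> \<ge> r\<close> have mass at most \<open>C * (\<rho> / \<delta>) powr s\<close>; the loss
  \<open>\<delta> powr - s = r powr (- \<theta> * s)\<close> is harmless because \<open>\<theta>\<close> can be taken as small as one likes.
  A random subspace satisfies \<open>|P\<^sub>V x| \<le> r\<close> with probability at most \<open>C * (r / |x|) ^ m\<close>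
  (\<open>grassmannian_haar_slab\<close>), so on average the pairs of points whose projections are at distance at
  most \<open>r\<close> have mass at most \<open>C * r powr ((1 - \<theta>) * s)\<close> (\<open>expected_energy_le\<close>). By Cauchy-Schwarz,
  a projection with few close pairs needs many sets of diameter at most \<open>r\<close>
  (\<open>covering_number_energy\<close>). Markov's inequality and the Borel-Cantelli lemma along a sequence of
  scales bounded by \<open>(1/2) ^ k\<close> make this hold for almost every \<open>V\<close> at all but finitely many
  of the scales (\<open>AE_eventually_covering_number_ge\<close>). For the lower dimensions the
  scales are all the powers of \<open>1/2\<close>; for the upper ones they are any sequence of scales without
  economical covers. In both cases the box dimension of the projection is at least
  \<open>(1 - \<theta>) * s - \<eta>\<close> for an arbitrarily small \<open>\<eta>\<close>, a quantity that can be made as close to \<open>m\<close> as desired.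
\<close>

section \<open>Orthogonal projections and the Grassmannian\<close>

lemma orth_proj_eqI:
  assumes V: "subspace V" and y: "y \<in> V" and o: "\<And>v. v \<in> V \<Longrightarrow> (x - y) \<bullet> v = 0"
  shows "orth_proj V x = y"
  unfolding orth_proj_def
proof (rule the_equality)
  show "y \<in> V \<and> (\<forall>v\<in>V. orthogonal (x - y) v)"
    using y o by (simp add: orthogonal_def)
next
  fix z assume z: "z \<in> V \<and> (\<forall>v\<in>V. orthogonal (x - z) v)"
  have "z - y \<in> V" using V y z by (simp add: subspace_diff)
  then have "(x - y) \<bullet> (z - y) = 0" "(x - z) \<bullet> (z - y) = 0"
    using o z by (auto simp: orthogonal_def)
  then have "(z - y) \<bullet> (z - y) = 0" by (simp add: inner_diff_left)
  then show "z = y" by simp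
qed

lemma
  assumes V: "subspace V"
  shows orth_proj_in: "orth_proj V x \<in> V"
    and orth_proj_inner: "v \<in> V \<Longrightarrow> orth_proj V x \<bullet> v = x \<bullet> v"
proof -
  obtain y z where yz: "y \<in> span V" "\<And>w. w \<in> span V \<Longrightarrow> orthogonal z w" "x = y + z"
    using orthogonal_subspace_decomp_exists by blast
  then have y: "y \<in> V" and z: "\<And>v. v \<in> V \<Longrightarrow> z \<bullet> v = 0"
    using V by (auto simp: orthogonal_def span_eq_iff[THEN iffD2])
  have eq: "orth_proj V x = y"
    by (rule orth_proj_eqI[OF V y]) (simp add: yz z)
  show "orth_proj V x \<in> V" using eq y by simp
  show "orth_proj V x \<bullet> v = x \<bullet> v" if "v \<in> V"
    using eq z[OF that] yz(3) by (simp add: inner_add_left)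
qed

lemma linear_orth_proj:
  assumes V: "subspace V"
  shows "linear (orth_proj V)"
proof (rule linearI)
  show "orth_proj V (x + y) = orth_proj V x + orth_proj V y" for x y
    by (rule orth_proj_eqI[OF V])
      (simp_all add: V orth_proj_in orth_proj_inner subspace_add inner_diff_left inner_add_left)
  show "orth_proj V (c *\<^sub>R x) = c *\<^sub>R orth_proj V x" for c x
    by (rule orth_proj_eqI[OF V])
      (simp_all add: V orth_proj_in orth_proj_inner subspace_scale inner_diff_left)
qed

lemma norm_orth_proj_le:
  assumes V: "subspace V"
  shows "norm (orth_proj V x) \<le> norm x"
proof -
  have "(norm (orth_proj V x))\<^sup>2 = x \<bullet> orth_proj V x"
    by (simp add: power2_norm_eq_inner orth_proj_inner[OF V orth_proj_in[OF V]])
  also have "\<dots> \<le> norm x * norm (orth_proj V x)"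
    by (rule norm_cauchy_schwarz)
  finally show ?thesis
    by (cases "orth_proj V x = 0") (simp_all add: power2_eq_square)
qed

lemma bounded_orth_proj_image:
  assumes "subspace V" "bounded F"
  shows "bounded (orth_proj V ` F)"
  using assms by (intro bounded_linear_image) (simp_all add: linear_orth_proj flip: linear_conv_bounded_linear)

lemma orth_proj_orthogonal_image:
  assumes V: "subspace V" and g: "orthogonal_transformation g"
  shows "orth_proj (g ` V) (g x) = g (orth_proj V x)"
proof -
  have lin: "linear g" using g by (simp add: orthogonal_transformation_linear)
  show ?thesis
  proof (rule orth_proj_eqI)
    show "subspace (g ` V)" using lin V by (rule linear_subspace_image)
    show "g (orth_proj V x) \<in> g ` V" by (simp add: V orth_proj_in)
    fix w assume "w \<in> g ` V"
    then obtain v where v: "w = g v" "v \<in> V" by blast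
    have "(g x - g (orth_proj V x)) \<bullet> g v = (x - orth_proj V x) \<bullet> v"
      using g by (simp add: inner_diff_left orthogonal_transformation_def)
    then show "(g x - g (orth_proj V x)) \<bullet> w = 0"
      using v orth_proj_inner[OF V] by (simp add: inner_diff_left)
  qed
qed

lemma grassmannian_orthogonal_image_iff:
  assumes g: "orthogonal_transformation g"
  shows "g ` V \<in> grassmannian m \<longleftrightarrow> V \<in> grassmannian m"
proof -
  have lin: "linear g" and inj: "inj g"
    using g by (simp_all add: orthogonal_transformation_linear orthogonal_transformation_inj)
  have "V \<in> grassmannian m \<Longrightarrow> g ` V \<in> grassmannian m" 
    using lin inj by (simp add: grassmannian_def linear_subspace_image dim_image_eq inj_on_subset)
  moreover have "V \<in> grassmannian m" if "g ` V \<in> grassmannian m"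
  proof -
    have "subspace (g -` (g ` V))"
      using that lin by (auto simp: grassmannian_def intro: linear_subspace_vimage)
    then have "subspace V" using inj by (simp add: inj_vimage_image_eq)
    then show ?thesis using that lin inj
      by (simp add: grassmannian_def dim_image_eq inj_on_subset)
  qed
  ultimately show ?thesis by blast
qed

lemma grassmannian_haarD:
  assumes "grassmannian_haar m \<gamma>"
  shows "prob_space \<gamma>" and "sets \<gamma> = sets (grassmannian_borel m)"
    and "space \<gamma> = grassmannian m"
  using assms sets_eq_imp_space_eq[of \<gamma> "grassmannian_borel m"]
  by (auto simp: grassmannian_haar_def grassmannian_borel_def)

text \<open>
  Joint measurability is what allows Fubini's theorem to be applied to the incidence set of
  subspaces and vectors below. It holds because the matrix of the projection is a measurable
  function of the subspace, and applying a matrix to a vector is continuous.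
\<close>
lemma measurable_orth_proj_pair:
  fixes \<gamma> :: "(real ^ 'd) set measure"
  assumes \<gamma>: "grassmannian_haar m \<gamma>"
  shows "(\<lambda>(V, x). orth_proj V x) \<in> borel_measurable (\<gamma> \<Otimes>\<^sub>M borel)"
proof -
  note h = grassmannian_haarD[OF \<gamma>]
  have "(\<lambda>V. matrix (orth_proj V)) \<in> borel_measurable (grassmannian_borel m :: (real ^ 'd) set measure)"
    unfolding grassmannian_borel_def by (rule measurable_vimage_algebra1) simp
  then have [measurable]: "(\<lambda>V. matrix (orth_proj V)) \<in> borel_measurable \<gamma>"
    using h(2) measurable_cong_sets by blast
  have cont: "continuous_on UNIV (\<lambda>p::(real^'d^'d) \<times> (real^'d). fst p *v snd p)"
    unfolding matrix_vector_mult_def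
    by (intro continuous_intros)
  have "(\<lambda>p. fst (matrix (orth_proj (fst p)), snd p) *v snd (matrix (orth_proj (fst p)), snd p)) \<in> borel_measurable (\<gamma> \<Otimes>\<^sub>M borel)"
    by (rule borel_measurable_continuous_on[OF cont]) measurable
  also have "?this \<longleftrightarrow> ?thesis"
  proof (rule measurable_cong)
    fix p assume "p \<in> space (\<gamma> \<Otimes>\<^sub>M (borel :: (real^'d) measure))"
    then have "subspace (fst p)" using h by (auto simp: space_pair_measure grassmannian_def)
    then show "fst (matrix (orth_proj (fst p)), snd p) *v snd (matrix (orth_proj (fst p)), snd p) = (case p of (V, x) \<Rightarrow> orth_proj V x)"
      by (simp add: case_prod_beta matrix_works linear_orth_proj)
  qed
  finally show ?thesis .
qed

lemma measurable_orth_proj: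
  assumes \<gamma>: "grassmannian_haar m \<gamma>"
  shows "(\<lambda>V. orth_proj V x) \<in> borel_measurable \<gamma>"
  using measurable_compose[OF measurable_Pair2'[of x borel \<gamma>] measurable_orth_proj_pair[OF \<gamma>]] by simp

section \<open>Probability that a random subspace is nearly orthogonal to a vector\<close>

lemma emeasure_lborel_translate:
  fixes S :: "'a::euclidean_space set"
  assumes "S \<in> sets borel"
  shows "emeasure lborel ((\<lambda>y. v + y) ` S) = emeasure lborel S"
proof -
  have eq: "(\<lambda>y. v + y) ` S = (\<lambda>y. - v + y) -` S"
  proof (intro equalityI subsetI)
    fix x assume "x \<in> (\<lambda>y. - v + y) -` S"
    then have "v + (- v + x) \<in> (\<lambda>y. v + y) ` S" by (intro imageI) simp
    then show "x \<in> (\<lambda>y. v + y) ` S" by simp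
  qed auto
  have "emeasure lborel S = emeasure (distr lborel borel ((+) (- v))) S"
    by (simp add: lborel_distr_plus)
  also have "\<dots> = emeasure lborel ((\<lambda>y. - v + y) -` S)"
    using assms by (subst emeasure_distr) auto
  finally show ?thesis using eq by simp
qed

text \<open>
  A packing argument: if \<open>b\<close> ranges over an orthonormal basis of \<open>V\<close>, the translates of the slab by
  the vectors \<open>\<Sum>b. 3 * r * k b * b\<close> with \<open>0 \<le> k b < n\<close> are disjoint, because their projections to
  \<open>V\<close> are contained in balls of radius \<open>r\<close> with centres at least \<open>3 * r\<close> apart. With \<open>n\<close> about \<open>1 / r\<close>
  they all stay in a ball of bounded radius, and there are at least \<open>(1 / r) ^ dim V\<close> of them.
  This uses only the translation invariance of Lebesgue measure, so that \<open>V\<close> need not be rotated to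
  a coordinate subspace.
\<close>
lemma slab_volume_le:
  fixes V :: "'a::euclidean_space set"
  assumes V: "subspace V" and r: "0 < r" "r \<le> 1"
  shows "emeasure lborel {y \<in> cball 0 1. norm (orth_proj V y) \<le> r}
         \<le> ennreal (measure lborel (cball (0::'a) (1 + 6 * real (dim V))) * r ^ dim V)"
proof -
  define S where "S = {y \<in> cball 0 1. norm (orth_proj V y) \<le> r}"
  let ?R = "1 + 6 * real (dim V)"
  obtain B where B: "B \<subseteq> V" "pairwise orthogonal B" "\<And>x. x \<in> B \<Longrightarrow> norm x = 1"
    "independent B" "card B = dim V" "span B = V"
    using orthonormal_basis_subspace[OF V] by blast
  have finB: "finite B" using B(4) by (rule independent_imp_finite)
  define n where "n = nat \<lceil>1 / r\<rceil>"
  have n1: "1 / r \<le> real n" unfolding n_def by linarith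
  have "real n \<le> 1 / r + 1" unfolding n_def using r by (simp add: of_nat_nat)
  then have n2: "r * real n \<le> 2" using r by (simp add: field_simps)
  define K where "K = PiE B (\<lambda>_. {..<n})"
  define v where "v k = (\<Sum>b\<in>B. (3 * r * real (k b)) *\<^sub>R b)" for k :: "'a \<Rightarrow> nat"
  have finK: "finite K" unfolding K_def using finB by (intro finite_PiE) auto
  have cardK: "card K = n ^ dim V" unfolding K_def using finB B(5) by (simp add: card_PiE)
  have vV: "v k \<in> V" for k
    unfolding v_def using V B(1) by (intro subspace_sum) (auto intro: subspace_scale)
  have vb: "v k \<bullet> b = 3 * r * real (k b)" if "b \<in> B" for k b
  proof -
    have "v k \<bullet> b = (\<Sum>b'\<in>B. 3 * r * real (k b') * (b' \<bullet> b))"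
      unfolding v_def by (simp add: inner_sum_left)
    also have "\<dots> = (\<Sum>b'\<in>B. if b' = b then 3 * r * real (k b') else 0)"
      using that B(2,3) by (intro sum.cong) (auto simp: pairwise_def orthogonal_def norm_eq_1)
    finally show ?thesis using that finB by simp
  qed
  have vn: "norm (v k) \<le> 6 * real (dim V)" if "k \<in> K" for k
  proof -
    have "norm (v k) \<le> (\<Sum>b\<in>B. norm ((3 * r * real (k b)) *\<^sub>R b))"
      unfolding v_def by (rule norm_sum)
    also have "\<dots> \<le> (\<Sum>b\<in>B. 6)"
    proof (rule sum_mono)
      fix b assume b: "b \<in> B"
      then have "real (k b) \<le> real n" using that by (auto simp: K_def PiE_def Pi_def less_imp_le)
      then have "r * real (k b) \<le> r * real n" using r by (intro mult_left_mono) auto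
      then have "3 * r * real (k b) \<le> 6" using n2 by linarith
      then show "norm ((3 * r * real (k b)) *\<^sub>R b) \<le> 6" using B(3)[OF b] r by simp
    qed
    finally show ?thesis using B(5) by simp
  qed
  have linP: "linear (orth_proj V)" using V by (rule linear_orth_proj)
  have cS: "closed S"
  proof -
    have "continuous_on UNIV (orth_proj V)"
      using linP by (simp add: linear_conv_bounded_linear linear_continuous_on)
    then have "closed {y. norm (orth_proj V y) \<le> r}"
      by (intro closed_Collect_le continuous_intros)
    moreover have "S = cball 0 1 \<inter> {y. norm (orth_proj V y) \<le> r}" by (auto simp: S_def)
    ultimately show ?thesis by auto
  qed
  then have bS: "S \<in> sets borel" by simp
  have disj: "disjoint_family_on (\<lambda>k. (\<lambda>y. v k + y) ` S) K"
    unfolding disjoint_family_on_def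
  proof (intro ballI impI, rule ccontr)
    fix k l assume kl: "k \<in> K" "l \<in> K" "k \<noteq> l"
      and ne: "(\<lambda>y. v k + y) ` S \<inter> (\<lambda>y. v l + y) ` S \<noteq> {}"
    obtain b where b: "b \<in> B" "k b \<noteq> l b" using kl unfolding K_def by (meson PiE_ext)
    obtain y z where yz: "y \<in> S" "z \<in> S" "v k + y = v l + z" using ne by blast
    have "v k - v l = z - y" using yz(3) by (simp add: algebra_simps)
    moreover have "3 * r * (real (k b) - real (l b)) = (v k - v l) \<bullet> b"
      by (simp add: vb[OF b(1)] inner_diff_left right_diff_distrib)
    ultimately have "3 * r * (real (k b) - real (l b)) = (z - y) \<bullet> b" by simp
    also have "\<dots> = (orth_proj V z - orth_proj V y) \<bullet> b"
      using b(1) B(1) V by (simp add: inner_diff_left orth_proj_inner subset_iff)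
    finally have "\<bar>3 * r * (real (k b) - real (l b))\<bar> \<le> norm (orth_proj V z - orth_proj V y) * norm b"
      using Cauchy_Schwarz_ineq2[of "orth_proj V z - orth_proj V y" b] by simp
    also have "\<dots> \<le> r + r"
      using norm_triangle_ineq4[of "orth_proj V z" "orth_proj V y"] yz B(3)[OF b(1)] by (simp add: S_def)
    finally have "\<bar>real (k b) - real (l b)\<bar> * (3 * r) \<le> 2 * r" using r by (simp add: abs_mult mult_ac)
    moreover have "1 \<le> \<bar>real (k b) - real (l b)\<bar>" using b(2) by linarith
    then have "1 * (3 * r) \<le> \<bar>real (k b) - real (l b)\<bar> * (3 * r)" using r by (intro mult_right_mono) auto
    ultimately show False using r by simp
  qed
  have "of_nat (card K) * emeasure lborel S = (\<Sum>k\<in>K. emeasure lborel ((\<lambda>y. v k + y) ` S))"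
    by (simp add: emeasure_lborel_translate[OF bS])
  also have "\<dots> = emeasure lborel (\<Union>k\<in>K. (\<lambda>y. v k + y) ` S)"
    using finK disj closed_translation[OF cS] by (intro sum_emeasure) auto
  also have "\<dots> \<le> emeasure lborel (cball (0::'a) ?R)"
  proof (rule emeasure_mono)
    show "(\<Union>k\<in>K. (\<lambda>y. v k + y) ` S) \<subseteq> cball 0 ?R"
    proof clarsimp
      fix k y assume "k \<in> K" "y \<in> S"
      then show "norm (v k + y) \<le> ?R"
        using norm_triangle_ineq[of "v k" y] vn[of k] by (simp add: S_def)
    qed
  qed simp
  also have "\<dots> = ennreal (measure lborel (cball (0::'a) ?R))"
    by (intro emeasure_eq_ennreal_measure less_imp_neq) (use emeasure_lborel_cball_finite in simp)
  finally have main: "of_nat (card K) * emeasure lborel S \<le> ennreal (measure lborel (cball (0::'a) ?R))" .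
  have fin: "emeasure lborel S = ennreal (measure lborel S)"
  proof (rule emeasure_eq_ennreal_measure)
    have "emeasure lborel S \<le> emeasure lborel (cball (0::'a) 1)"
      by (rule emeasure_mono) (auto simp: S_def)
    also have "\<dots> < \<infinity>" by (rule emeasure_lborel_cball_finite)
    finally show "emeasure lborel S \<noteq> top" by simp
  qed
  have "real (card K) * measure lborel S \<le> measure lborel (cball (0::'a) ?R)"
    using main unfolding fin by (simp add: ennreal_of_nat_eq_real_of_nat flip: ennreal_mult)
  then have "real n ^ dim V * measure lborel S \<le> measure lborel (cball (0::'a) ?R)"
    using cardK by simp
  moreover have "(1 / r) ^ dim V * measure lborel S \<le> real n ^ dim V * measure lborel S"
    using n1 r by (intro mult_right_mono power_mono) auto
  ultimately have "(1 / r) ^ dim V * measure lborel S \<le> measure lborel (cball (0::'a) ?R)" by simp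
  then have "measure lborel S \<le> measure lborel (cball (0::'a) ?R) * r ^ dim V"
    using r by (simp add: power_divide field_simps)
  then show ?thesis using fin unfolding S_def by (simp add: ennreal_leI)
qed

text \<open>
  A rotation \<open>g\<close> that takes \<open>x\<close> to \<open>y\<close> maps the subspaces on which \<open>x\<close> has a short projection onto those
  on which \<open>y\<close> does.
\<close>
lemma grassmannian_haar_slab_rotate:
  assumes \<gamma>: "grassmannian_haar m \<gamma>" and n: "norm x = norm y"
  shows "emeasure \<gamma> {V \<in> space \<gamma>. norm (orth_proj V x) \<le> r}
       = emeasure \<gamma> {V \<in> space \<gamma>. norm (orth_proj V y) \<le> r}"
proof -
  note h = grassmannian_haarD[OF \<gamma>]
  obtain g where g: "orthogonal_transformation g" "g x = y"
    using orthogonal_transformation_exists[OF n] by blast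
  let ?A = "{V \<in> space \<gamma>. norm (orth_proj V x) \<le> r}"
  have A: "?A \<in> sets \<gamma>" using measurable_orth_proj[OF \<gamma>, of x] by measurable
  have inv: "orthogonal_transformation (inv g)" and surj: "surj g"
    using g(1) by (simp_all add: orthogonal_transformation_inv orthogonal_transformation_surj)
  have iff: "norm (orth_proj (g ` V) y) = norm (orth_proj V x)" if "V \<in> grassmannian m" for V
    using that orth_proj_orthogonal_image[of V g x] g orthogonal_transformation_norm[OF g(1)]
    by (simp add: grassmannian_def)
  have "(\<lambda>V. g ` V) ` ?A = {V \<in> space \<gamma>. norm (orth_proj V y) \<le> r}" (is "_ = ?C")
  proof
    show "(\<lambda>V. g ` V) ` ?A \<subseteq> ?C"
      using h(3) iff by (auto simp: grassmannian_orthogonal_image_iff[OF g(1)])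
    show "?C \<subseteq> (\<lambda>V. g ` V) ` ?A"
    proof
      fix W assume W: "W \<in> ?C"
      have eq: "W = g ` (inv g ` W)" using surj by (simp add: image_f_inv_f)
      have "inv g ` W \<in> grassmannian m"
        using W h(3) by (simp add: grassmannian_orthogonal_image_iff[OF inv])
      moreover from this have "norm (orth_proj (inv g ` W) x) = norm (orth_proj W y)"
        using iff[of "inv g ` W"] unfolding eq[symmetric] by simp
      ultimately have "inv g ` W \<in> ?A" using W h(3) by simp
      then show "W \<in> (\<lambda>V. g ` V) ` ?A" using eq by blast
    qed
  qed
  moreover have "emeasure \<gamma> ((\<lambda>V. g ` V) ` ?A) = emeasure \<gamma> ?A"
    using \<gamma> g(1) A unfolding grassmannian_haar_def by simp
  ultimately show ?thesis by simp
qed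

text \<open>
  The ratio of the volume of the ball that contains all translates in the packing argument to the
  volume of the unit ball, over which the rotation-invariant probability is averaged.
\<close>
definition slab_const :: "'a::euclidean_space itself \<Rightarrow> nat \<Rightarrow> real" where
  "slab_const _ m = measure lborel (cball (0::'a) (1 + 6 * real m)) / measure lborel (cball (0::'a) 1)"

text \<open>
  By rotation invariance the probability is the same for all unit vectors, and may be averaged over
  the unit ball. By Fubini this average is the expected volume of the slab
  \<open>{y. norm (orth_proj V y) \<le> r}\<close> inside the ball, which is of order \<open>r ^ m\<close> for every \<open>V\<close>.
\<close>
lemma grassmannian_haar_slab_unit:
  fixes \<gamma> :: "(real ^ 'd) set measure"
  assumes \<gamma>: "grassmannian_haar m \<gamma>" and x: "norm x = 1" and r: "0 < r" "r \<le> 1"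
  shows "measure \<gamma> {V \<in> space \<gamma>. norm (orth_proj V x) \<le> r}
         \<le> slab_const TYPE(real ^ 'd) m * r ^ m"
proof -
  note h = grassmannian_haarD[OF \<gamma>]
  interpret prob_space \<gamma> by (rule h)
  interpret P: pair_sigma_finite \<gamma> "lborel :: (real ^ 'd) measure" ..
  let ?b = "emeasure lborel (cball (0::real^'d) 1)"
  let ?c = "measure lborel (cball (0::real^'d) (1 + 6 * real m))"
  let ?p = "emeasure \<gamma> {V \<in> space \<gamma>. norm (orth_proj V x) \<le> r}"
  \<comment> \<open>The condition is homogeneous in \<open>y\<close>, so that all nonzero \<open>y\<close> have the same probability;
    the origin satisfies it for every subspace.\<close>
  define f :: "(real^'d) set \<Rightarrow> real^'d \<Rightarrow> ennreal" where
    "f V y = indicator {(V, y). y \<in> cball 0 1 \<and> norm (orth_proj V y) \<le> r * norm y} (V, y)" for V y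
  have fm: "(\<lambda>(V, y). f V y) \<in> borel_measurable (\<gamma> \<Otimes>\<^sub>M lborel)"
  proof -
    have [measurable]: "(\<lambda>p. orth_proj (fst p) (snd p)) \<in> borel_measurable (\<gamma> \<Otimes>\<^sub>M borel)"
      using measurable_orth_proj_pair[OF \<gamma>] by (simp add: case_prod_beta')
    have "(\<lambda>p. indicator {..1} (norm (snd p))
          * indicator {..0} (norm (orth_proj (fst p) (snd p)) - r * norm (snd p)) :: ennreal)
        \<in> borel_measurable (\<gamma> \<Otimes>\<^sub>M borel)"
      by measurable
    also have "(\<lambda>p. indicator {..1} (norm (snd p))
          * indicator {..0} (norm (orth_proj (fst p) (snd p)) - r * norm (snd p)) :: ennreal)
       = (\<lambda>(V, y). f V y)"
      by (auto simp: f_def fun_eq_iff split: split_indicator)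
    finally show ?thesis by simp
  qed
  have "?p * ?b = (\<integral>\<^sup>+ y. ?p * indicator (cball (0::real^'d) 1) y \<partial>lborel)"
    by (simp add: nn_integral_cmult_indicator)
  also have "\<dots> \<le> (\<integral>\<^sup>+ y. (\<integral>\<^sup>+ V. f V y \<partial>\<gamma>) \<partial>lborel)"
  proof (rule nn_integral_mono)
    fix y :: "real ^ 'd"
    show "?p * indicator (cball 0 1) y \<le> (\<integral>\<^sup>+ V. f V y \<partial>\<gamma>)"
    proof (cases "y \<in> cball 0 1")
      case True
      let ?S = "{V \<in> space \<gamma>. norm (orth_proj V y) \<le> r * norm y}"
      have S: "?S \<in> sets \<gamma>" using measurable_orth_proj[OF \<gamma>, of y] by measurable
      have "(\<integral>\<^sup>+ V. f V y \<partial>\<gamma>) = (\<integral>\<^sup>+ V. indicator ?S V \<partial>\<gamma>)"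
        using True by (intro nn_integral_cong) (auto simp: f_def split: split_indicator)
      also have "\<dots> = emeasure \<gamma> ?S" using S by simp
      also have "?p \<le> emeasure \<gamma> ?S"
      proof (cases "y = 0")
        case True
        have "{V \<in> space \<gamma>. norm (orth_proj V x) \<le> r} \<subseteq> ?S"
          using True h(3) by (auto simp: grassmannian_def linear_0[OF linear_orth_proj])
        then show ?thesis using S by (rule emeasure_mono)
      next
        case False
        have "?S = {V \<in> space \<gamma>. norm (orth_proj V (y /\<^sub>R norm y)) \<le> r}"
          using False h(3) by (auto simp: grassmannian_def linear_cmul[OF linear_orth_proj] field_simps)
        then show ?thesis
          using grassmannian_haar_slab_rotate[OF \<gamma>, of x "y /\<^sub>R norm y" r] x False by simp
      qed
      finally show ?thesis using True by simp
    qed simp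
  qed
  also have "\<dots> = (\<integral>\<^sup>+ V. (\<integral>\<^sup>+ y. f V y \<partial>lborel) \<partial>\<gamma>)"
    by (rule P.Fubini'[OF fm])
  also have "\<dots> \<le> (\<integral>\<^sup>+ V. ennreal (?c * r ^ m) \<partial>\<gamma>)"
  proof (rule nn_integral_mono)
    fix V assume "V \<in> space \<gamma>"
    then have V: "subspace V" "dim V = m" using h(3) by (auto simp: grassmannian_def)
    let ?S = "{y \<in> cball 0 1. norm (orth_proj V y) \<le> r}"
    have bl: "bounded_linear (orth_proj V)"
      using linear_orth_proj[OF V(1)] by (simp add: linear_conv_bounded_linear)
    have [measurable]: "orth_proj V \<in> borel_measurable borel"
      using bl by (intro borel_measurable_continuous_onI linear_continuous_on)
    have S: "?S \<in> sets borel" by measurable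
    have "(\<integral>\<^sup>+ y. f V y \<partial>lborel) \<le> (\<integral>\<^sup>+ y. indicator ?S y \<partial>lborel)"
    proof (intro nn_integral_mono)
      fix y :: "real ^ 'd"
      have "r * norm y \<le> r" if "norm y \<le> 1" using that r by (simp add: mult_left_le)
      then show "f V y \<le> indicator ?S y"
        by (force simp: f_def split: split_indicator)
    qed
    also have "\<dots> = emeasure lborel ?S" using S by simp
    also have "\<dots> \<le> ennreal (?c * r ^ m)" using slab_volume_le[OF V(1) r] V(2) by simp
    finally show "(\<integral>\<^sup>+ y. f V y \<partial>lborel) \<le> ennreal (?c * r ^ m)" .
  qed
  also have "\<dots> = ennreal (?c * r ^ m)" by (simp add: emeasure_space_1)
  finally have *: "?p * ?b \<le> ennreal (?c * r ^ m)" .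
  have b: "?b = ennreal (measure lborel (cball (0::real^'d) 1))"
    by (intro emeasure_eq_ennreal_measure less_imp_neq) (use emeasure_lborel_cball_finite in simp)
  have bpos: "0 < measure lborel (cball (0::real^'d) 1)"
    using content_cball_pos[of 1 "0::real^'d"] by simp
  have "measure \<gamma> {V \<in> space \<gamma>. norm (orth_proj V x) \<le> r} * measure lborel (cball (0::real^'d) 1) \<le> ?c * r ^ m"
    using * r unfolding b emeasure_eq_measure by (simp flip: ennreal_mult)
  then show ?thesis using bpos by (simp add: slab_const_def field_simps)
qed

lemma grassmannian_haar_slab:
  fixes \<gamma> :: "(real ^ 'd) set measure"
  assumes \<gamma>: "grassmannian_haar m \<gamma>" and r: "0 < r" "r \<le> norm x"
  shows "measure \<gamma> {V \<in> space \<gamma>. norm (orth_proj V x) \<le> r}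
         \<le> slab_const TYPE(real ^ 'd) m * (r / norm x) ^ m"
proof -
  note h = grassmannian_haarD[OF \<gamma>]
  have x: "norm x > 0" using r by linarith
  have "{V \<in> space \<gamma>. norm (orth_proj V x) \<le> r}
      = {V \<in> space \<gamma>. norm (orth_proj V (x /\<^sub>R norm x)) \<le> r / norm x}"
    using x h(3) by (auto simp: grassmannian_def linear_cmul[OF linear_orth_proj] field_simps)
  then show ?thesis
    using grassmannian_haar_slab_unit[OF \<gamma>, of "x /\<^sub>R norm x" "r / norm x"] x r by simp
qed

section \<open>Covering numbers and box dimensions\<close>

lemma finite_net_exists:
  fixes E :: "'a::euclidean_space set"
  assumes "bounded E" "0 < r"
  obtains X where "finite X" "X \<subseteq> E" "E \<subseteq> (\<Union>x\<in>X. ball x r)"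
proof -
  have "seq_compact (closure E)" using assms(1) by (simp add: compact_imp_seq_compact)
  from seq_compact_imp_totally_bounded[OF this, rule_format, of "r/2"] assms(2)
  obtain k where k: "finite k" "closure E \<subseteq> (\<Union>x\<in>k. ball x (r/2))" by auto
  define k' where "k' = {x \<in> k. E \<inter> ball x (r/2) \<noteq> {}}"
  have "\<forall>x\<in>k'. \<exists>y. y \<in> E \<and> dist x y < r/2" by (auto simp: k'_def)
  from bchoice[OF this] obtain g where g: "\<And>x. x \<in> k' \<Longrightarrow> g x \<in> E \<and> dist x (g x) < r/2" by blast
  have "E \<subseteq> (\<Union>x\<in>g ` k'. ball x r)"
  proof
    fix y assume y: "y \<in> E"
    then have "y \<in> closure E" using closure_subset by (rule subsetD[rotated])
    then obtain x where x: "x \<in> k" "dist x y < r/2" using k(2) by auto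
    then have xk: "x \<in> k'" using y by (auto simp: k'_def)
    have "dist (g x) y < r"
      using dist_triangle3[of "g x" y x] g[OF xk] x(2) by linarith
    then show "y \<in> (\<Union>x\<in>g ` k'. ball x r)" using xk by auto
  qed
  then show ?thesis using g k(1) by (intro that[of "g ` k'"]) (auto simp: k'_def)
qed

lemma covering_number_witness:
  fixes F :: "'a::euclidean_space set"
  assumes "bounded F" "0 < r"
  obtains \<U> where "finite \<U>" "card \<U> = covering_number F r" "F \<subseteq> \<Union>\<U>"
    "\<forall>U\<in>\<U>. bounded U \<and> diameter U \<le> r"
proof -
  let ?P = "\<lambda>n. \<exists>\<U>. finite \<U> \<and> card \<U> = n \<and> F \<subseteq> \<Union>\<U> \<and>
    (\<forall>U\<in>\<U>. bounded U \<and> diameter U \<le> r)"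
  have "0 < r / 2" using assms(2) by simp
  then obtain X where "finite X" "X \<subseteq> F" and X: "F \<subseteq> (\<Union>x\<in>X. ball x (r/2))"
    by (rule finite_net_exists[OF assms(1)])
  have "diameter (ball x (r/2)) \<le> r" for x :: 'a using assms(2) by simp
  then have "?P (card ((\<lambda>x. ball x (r/2)) ` X))"
    using \<open>finite X\<close> X by (intro exI[of _ "(\<lambda>x. ball x (r/2)) ` X"]) simp
  then have "?P (LEAST n. ?P n)" by (rule LeastI)
  then have "?P (covering_number F r)" unfolding covering_number_def .
  then obtain \<U> where "finite \<U>" "card \<U> = covering_number F r" "F \<subseteq> \<Union>\<U>"
    "\<forall>U\<in>\<U>. bounded U \<and> diameter U \<le> r" by (elim exE conjE)
  then show ?thesis by (intro that[of \<U>]) simp_all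
qed

lemma covering_number_le_card:
  assumes "finite \<U>" "F \<subseteq> \<Union>\<U>" "\<And>U. U \<in> \<U> \<Longrightarrow> bounded U \<and> diameter U \<le> r"
  shows "covering_number F r \<le> card \<U>"
  unfolding covering_number_def by (rule Least_le) (use assms in blast)

lemma covering_number_ge_1:
  assumes "bounded F" "F \<noteq> {}" "0 < r"
  shows "1 \<le> covering_number F r"
proof -
  obtain \<U> where U: "finite \<U>" "card \<U> = covering_number F r" "F \<subseteq> \<Union>\<U>"
    "\<forall>U\<in>\<U>. bounded U \<and> diameter U \<le> r"
    by (rule covering_number_witness[OF assms(1,3)])
  have "\<U> \<noteq> {}" using U(3) assms(2) by auto
  then have "card \<U> \<noteq> 0" using U(1) by simp
  then show ?thesis using U(2) by simp
qed

lemma covering_number_antimono: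
  assumes "bounded F" "0 < r" "r \<le> r'"
  shows "covering_number F r' \<le> covering_number F r"
proof -
  obtain \<U> where U: "finite \<U>" "card \<U> = covering_number F r" "F \<subseteq> \<Union>\<U>"
    "\<forall>U\<in>\<U>. bounded U \<and> diameter U \<le> r"
    by (rule covering_number_witness[OF assms(1,2)])
  have "bounded U \<and> diameter U \<le> r'" if "U \<in> \<U>" for U using U(4) that assms(3) by force
  from covering_number_le_card[OF U(1,3) this] show ?thesis using U(2) by simp
qed

text \<open>
  Powers of \<open>1/2\<close> suffice: between two consecutive ones the covering number is monotone, and the error
  of a factor \<open>k / (k + 1)\<close> in the exponent is absorbed by the gap between \<open>u\<close> and \<open>t\<close>.
\<close>
lemma lower_box_dim_geI:
  fixes F :: "'a::euclidean_space set"
  assumes F: "bounded F" "F \<noteq> {}" and u: "0 \<le> u" "u < t"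
    and ev: "\<forall>\<^sub>F k in sequentially. ((1/2) ^ k) powr (- t) \<le> real (covering_number F ((1/2) ^ k))"
  shows "ereal u \<le> lower_box_dim F"
proof -
  obtain k0 where k0: "\<And>k. k0 \<le> k \<Longrightarrow> ((1/2) ^ k) powr (- t) \<le> real (covering_number F ((1/2) ^ k))"
    using ev unfolding eventually_sequentially by auto
  define K where "K = Suc (max k0 (nat \<lceil>u / (t - u)\<rceil>))"
  have "\<forall>\<^sub>F \<delta> in at_right (0::real). ereal u \<le> ereal (ln (real (covering_number F \<delta>)) / - ln \<delta>)"
  proof (rule eventually_at_rightI)
    show "(0::real) < (1/2) ^ K" by simp
    fix \<delta> :: real assume "\<delta> \<in> {0<..<(1/2) ^ K}"
    then have \<delta>: "0 < \<delta>" "\<delta> < (1/2) ^ K" by auto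
    define L where "L = - ln \<delta> / ln 2"
    have ln\<delta>: "- ln \<delta> = L * ln 2" by (simp add: L_def)
    have "ln \<delta> < ln ((1/2) ^ K)" using \<delta> by (subst ln_less_cancel_iff) auto
    also have "\<dots> = - (real K * ln 2)" by (simp add: ln_realpow ln_div)
    finally have "real K * ln 2 < L * ln 2" using ln\<delta> by linarith
    then have LK: "real K < L" by simp
    define k where "k = nat \<lfloor>L\<rfloor>"
    have kL: "real k \<le> L" "L < real k + 1" and Kk: "K \<le> k"
      using LK unfolding k_def by linarith+
    have L0: "0 < L" using LK by linarith
    have "ln \<delta> \<le> - (real k * ln 2)"
    proof -
      have "real k * ln 2 \<le> L * ln 2" using kL(1) by (intro mult_right_mono) auto
      then show ?thesis using ln\<delta> by linarith
    qed
    also have "\<dots> = ln ((1/2) ^ k)" by (simp add: ln_realpow ln_div)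
    finally have "\<delta> \<le> (1/2) ^ k" using \<delta>(1) by (subst (asm) ln_le_cancel_iff) auto
    then have "covering_number F ((1/2) ^ k) \<le> covering_number F \<delta>"
      using F \<delta>(1) by (intro covering_number_antimono) auto
    moreover have "((1/2) ^ k) powr (- t) \<le> real (covering_number F ((1/2) ^ k))"
      using Kk by (intro k0) (simp add: K_def)
    ultimately have "((1/2) ^ k) powr (- t) \<le> real (covering_number F \<delta>)" by linarith
    then have "ln (((1/2) ^ k) powr (- t)) \<le> ln (real (covering_number F \<delta>))"
    proof (subst ln_le_cancel_iff)
      show "0 < ((1/2) ^ k :: real) powr (- t)" by simp
      then show "0 < real (covering_number F \<delta>)"
        using \<open>((1/2) ^ k) powr (- t) \<le> real (covering_number F \<delta>)\<close> by linarith
    qed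
    moreover have "ln (((1/2) ^ k) powr (- t) :: real) = t * real k * ln 2"
      by (simp add: ln_powr ln_realpow ln_div)
    ultimately have N: "t * real k * ln 2 \<le> ln (real (covering_number F \<delta>))" by simp
    have "u / (t - u) \<le> real k" using Kk unfolding K_def by linarith
    then have "u \<le> real k * (t - u)" using u by (simp add: field_simps)
    then have "u * (real k + 1) \<le> t * real k" by (simp add: algebra_simps)
    moreover have "u * L \<le> u * (real k + 1)" using kL u by (intro mult_left_mono) auto
    ultimately have "u * L \<le> t * real k" by linarith
    then have "u * L * ln 2 \<le> t * real k * ln 2" by (intro mult_right_mono) auto
    then have "u * (L * ln 2) \<le> ln (real (covering_number F \<delta>))"
      using N unfolding mult.assoc by linarith
    moreover have "0 < L * ln 2" using L0 by simp
    ultimately have "u \<le> ln (real (covering_number F \<delta>)) / (L * ln 2)"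
      by (simp only: pos_le_divide_eq)
    then show "ereal u \<le> ereal (ln (real (covering_number F \<delta>)) / - ln \<delta>)"
      unfolding ln\<delta> by simp
  qed
  then show ?thesis unfolding lower_box_dim_def by (rule Liminf_bounded)
qed

lemma upper_box_dim_geI:
  fixes F :: "'a::euclidean_space set"
  assumes \<rho>: "\<And>k. 0 < \<rho> k" "\<rho> \<longlonglongrightarrow> 0"
    and ev: "\<forall>\<^sub>F k in sequentially. \<rho> k powr (- t) \<le> real (covering_number F (\<rho> k))"
  shows "ereal t \<le> upper_box_dim F"
proof (rule ccontr)
  assume "\<not> ereal t \<le> upper_box_dim F"
  then have "Limsup (at_right 0) (\<lambda>\<delta>. ereal (ln (real (covering_number F \<delta>)) / - ln \<delta>)) < ereal t"
    unfolding upper_box_dim_def by simp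
  then have "\<forall>\<^sub>F \<delta> in at_right (0::real). ereal (ln (real (covering_number F \<delta>)) / - ln \<delta>) < ereal t"
    by (rule Limsup_lessD)
  moreover have "filterlim \<rho> (at_right 0) sequentially"
    using \<rho> by (intro tendsto_imp_filterlim_at_right always_eventually) auto
  ultimately have "\<forall>\<^sub>F k in sequentially. ereal (ln (real (covering_number F (\<rho> k))) / - ln (\<rho> k)) < ereal t"
    by (rule eventually_compose_filterlim)
  moreover have "\<forall>\<^sub>F k in sequentially. \<rho> k < 1"
    using \<rho>(2) by (rule order_tendstoD) simp
  ultimately have "\<forall>\<^sub>F k in sequentially. False"
    using ev
  proof eventually_elim
    case (elim k)
    have "ln (\<rho> k powr (- t)) \<le> ln (real (covering_number F (\<rho> k)))"
    proof (subst ln_le_cancel_iff)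
      show "0 < \<rho> k powr (- t)" using \<rho>(1)[of k] by simp
      then show "0 < real (covering_number F (\<rho> k))" using elim(3) by linarith
    qed (fact elim(3))
    moreover have "ln (\<rho> k powr (- t)) = t * (- ln (\<rho> k))"
      using \<rho>(1)[of k] by (simp add: ln_powr)
    moreover have "0 < - ln (\<rho> k)" using elim(2) \<rho>(1)[of k] by simp
    ultimately have "t \<le> ln (real (covering_number F (\<rho> k))) / - ln (\<rho> k)"
      by (simp only: pos_le_divide_eq)
    then show ?case using elim(1) by simp
  qed
  then show False by simp
qed

lemma eventually_box_ratio_le:
  assumes C: "0 < C" and u: "t < u"
  shows "\<forall>\<^sub>F \<delta> in at_right (0::real). \<forall>N. 0 < N \<longrightarrow> N \<le> C * \<delta> powr (- t) \<longrightarrow> ln N / - ln \<delta> \<le> u"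
proof (rule eventually_at_rightI)
  let ?d = "min 1 (exp (- (ln C / (u - t))))"
  show "0 < ?d" by simp
  fix \<delta> assume "\<delta> \<in> {0<..<?d}"
  then have \<delta>: "0 < \<delta>" "\<delta> < 1" "\<delta> < exp (- (ln C / (u - t)))" by auto
  have "ln \<delta> < ln (exp (- (ln C / (u - t))))" using \<delta> by (subst ln_less_cancel_iff) auto
  then have "ln C / (u - t) < - ln \<delta>" by simp
  then have lnC: "ln C < (u - t) * - ln \<delta>" using u by (simp add: field_simps)
  show "\<forall>N. 0 < N \<longrightarrow> N \<le> C * \<delta> powr (- t) \<longrightarrow> ln N / - ln \<delta> \<le> u"
  proof (intro allI impI)
    fix N assume N: "0 < N" "N \<le> C * \<delta> powr (- t)"
    then have "ln N \<le> ln (C * \<delta> powr (- t))"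
      using C \<delta> by (subst ln_le_cancel_iff) auto
    also have "\<dots> = ln C + t * - ln \<delta>" using C \<delta> by (simp add: ln_mult ln_powr)
    also have "\<dots> \<le> u * - ln \<delta>" using lnC by (simp add: algebra_simps)
    finally have "ln N \<le> u * - ln \<delta>" .
    moreover have "0 < - ln \<delta>" using \<delta> by simp
    ultimately show "ln N / - ln \<delta> \<le> u" by (simp only: pos_divide_le_eq)
  qed
qed

lemma upper_box_dim_leI:
  fixes F :: "'a::euclidean_space set"
  assumes F: "bounded F" "F \<noteq> {}" and C: "0 < C" and u: "t < u"
    and ev: "\<forall>\<^sub>F \<delta> in at_right 0. real (covering_number F \<delta>) \<le> C * \<delta> powr (- t)"
  shows "upper_box_dim F \<le> ereal u"
proof -
  have "\<forall>\<^sub>F \<delta> in at_right 0. ereal (ln (real (covering_number F \<delta>)) / - ln \<delta>) \<le> ereal u"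
    using ev eventually_box_ratio_le[OF C u] eventually_at_right_less[of 0]
  proof eventually_elim
    case (elim \<delta>)
    then show ?case using covering_number_ge_1[OF F, of \<delta>] by simp
  qed
  then show ?thesis unfolding upper_box_dim_def by (rule Limsup_bounded)
qed

lemma lower_box_dim_leI:
  fixes F :: "'a::euclidean_space set"
  assumes F: "bounded F" "F \<noteq> {}" and C: "0 < C" and u: "t < u"
    and ev: "\<exists>\<^sub>F \<delta> in at_right 0. real (covering_number F \<delta>) \<le> C * \<delta> powr (- t)"
  shows "lower_box_dim F \<le> ereal u"
proof (rule ccontr)
  assume "\<not> lower_box_dim F \<le> ereal u"
  then have "ereal u < Liminf (at_right 0) (\<lambda>\<delta>. ereal (ln (real (covering_number F \<delta>)) / - ln \<delta>))"
    unfolding lower_box_dim_def by simp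
  then have "\<forall>\<^sub>F \<delta> in at_right 0. ereal u < ereal (ln (real (covering_number F \<delta>)) / - ln \<delta>)"
    by (rule less_LiminfD)
  then have "\<forall>\<^sub>F \<delta> in at_right 0. \<not> real (covering_number F \<delta>) \<le> C * \<delta> powr (- t)"
    using eventually_box_ratio_le[OF C u] eventually_at_right_less[of 0]
  proof eventually_elim
    case (elim \<delta>)
    show ?case
    proof
      assume "real (covering_number F \<delta>) \<le> C * \<delta> powr (- t)"
      then have "ln (real (covering_number F \<delta>)) / - ln \<delta> \<le> u"
        using elim(2) covering_number_ge_1[OF F elim(3)] by simp
      then show False using elim(1) by simp
    qed
  qed
  then show False using ev unfolding frequently_def by simp
qed

lemma lower_box_dim_le_upper: "lower_box_dim F \<le> upper_box_dim F"
  unfolding lower_box_dim_def upper_box_dim_def by (rule Liminf_le_Limsup) simp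

section \<open>A discrete Frostman lemma\<close>

text \<open>
  A greedy construction that replaces the usual rescaling of masses on dyadic cubes: the points are
  treated one after the other, and each receives the largest weight that the capacities of the sets
  containing it still permit. A set that is full stays full, since later points in it receive
  weight zero.
\<close>
lemma saturated_weights_exist:
  fixes c :: "'i \<Rightarrow> real" and Q :: "'i \<Rightarrow> 'a set"
  assumes "finite X" "finite I" and c: "\<And>i. i \<in> I \<Longrightarrow> 0 \<le> c i"
    and cov: "\<And>x. x \<in> X \<Longrightarrow> \<exists>i\<in>I. x \<in> Q i"
  obtains w :: "'a \<Rightarrow> real" where "\<And>x. 0 \<le> w x"
    "\<And>i. i \<in> I \<Longrightarrow> sum w (X \<inter> Q i) \<le> c i"
    "\<And>x. x \<in> X \<Longrightarrow> \<exists>i\<in>I. x \<in> Q i \<and> sum w (X \<inter> Q i) = c i"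
proof -
  have "\<exists>w. (\<forall>x. 0 \<le> w x) \<and> (\<forall>i\<in>I. sum w (X \<inter> Q i) \<le> c i) \<and>
      (\<forall>x\<in>X. \<exists>i\<in>I. x \<in> Q i \<and> sum w (X \<inter> Q i) = c i)"
    using assms(1) cov
  proof (induction X rule: finite_induct)
    case empty
    show ?case by (rule exI[of _ "\<lambda>_. 0"]) (simp add: c)
  next
    case (insert x X)
    then obtain w where w: "\<And>x. 0 \<le> w x" "\<And>i. i \<in> I \<Longrightarrow> sum w (X \<inter> Q i) \<le> c i"
      "\<And>y. y \<in> X \<Longrightarrow> \<exists>i\<in>I. y \<in> Q i \<and> sum w (X \<inter> Q i) = c i"
      by (metis insertI2)
    define J where "J = {i \<in> I. x \<in> Q i}"
    have J: "finite J" "J \<noteq> {}" using insert.prems assms(2) by (auto simp: J_def)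
    define t where "t = Min ((\<lambda>i. c i - sum w (X \<inter> Q i)) ` J)"
    have t_le: "t \<le> c i - sum w (X \<inter> Q i)" if "i \<in> J" for i
      unfolding t_def using J that by simp
    have "t \<in> (\<lambda>i. c i - sum w (X \<inter> Q i)) ` J"
      unfolding t_def using J by (intro Min_in) auto
    then obtain j where j: "j \<in> J" "t = c j - sum w (X \<inter> Q j)" by blast
    have t0: "0 \<le> t" using j w(2)[of j] by (simp add: J_def)
    define w' where "w' = w(x := t)"
    have in_sum: "sum w' (insert x X \<inter> Q i) = t + sum w (X \<inter> Q i)" if "x \<in> Q i" for i
    proof -
      have "sum w' (insert x X \<inter> Q i) = sum w' (insert x (X \<inter> Q i))"
        using that by (intro arg_cong2[where f=sum]) auto
      also have "\<dots> = w' x + sum w' (X \<inter> Q i)"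
        using insert.hyps by (intro sum.insert) auto
      also have "sum w' (X \<inter> Q i) = sum w (X \<inter> Q i)"
        using insert.hyps by (intro sum.cong) (auto simp: w'_def)
      finally show ?thesis by (simp add: w'_def)
    qed
    have out_sum: "sum w' (insert x X \<inter> Q i) = sum w (X \<inter> Q i)" if "x \<notin> Q i" for i
      using that insert.hyps by (intro sum.cong) (auto simp: w'_def)
    have le: "sum w' (insert x X \<inter> Q i) \<le> c i" if "i \<in> I" for i
      using that in_sum[of i] out_sum[of i] t_le[of i] w(2)[of i] by (cases "x \<in> Q i") (auto simp: J_def)
    have sat: "\<exists>i\<in>I. y \<in> Q i \<and> sum w' (insert x X \<inter> Q i) = c i" if "y \<in> insert x X" for y
    proof (cases "y = x")
      case True
      then show ?thesis using j in_sum[of j] by (auto simp: J_def)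
    next
      case False
      then have "y \<in> X" using that by simp
      then obtain i where i: "i \<in> I" "y \<in> Q i" "sum w (X \<inter> Q i) = c i" using w(3) by blast
      have "sum w' (insert x X \<inter> Q i) \<ge> sum w (X \<inter> Q i)"
        using in_sum[of i] out_sum[of i] t0 by (cases "x \<in> Q i") auto
      then show ?thesis using i le[OF i(1)] by (intro bexI[of _ i]) auto
    qed
    show ?case using le sat w(1) t0 by (intro exI[of _ w']) (auto simp: w'_def)
  qed
  then obtain w where "\<forall>x. 0 \<le> w x" "\<forall>i\<in>I. sum w (X \<inter> Q i) \<le> c i"
    "\<forall>x\<in>X. \<exists>i\<in>I. x \<in> Q i \<and> sum w (X \<inter> Q i) = c i" by (elim exE conjE)
  then show ?thesis by (intro that[of w]) simp_all
qed

lemma ennreal_infsum_image_le: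
  fixes f :: "'b \<Rightarrow> real"
  assumes "finite A" "\<And>a. a \<in> A \<Longrightarrow> 0 \<le> f (h a)"
  shows "(\<Sum>\<^sub>\<infinity>U\<in>h ` A. ennreal (f U)) \<le> ennreal (\<Sum>a\<in>A. f (h a))"
proof -
  have "(\<Sum>\<^sub>\<infinity>U\<in>h ` A. ennreal (f U)) = (\<Sum>U\<in>h ` A. ennreal (f U))"
    using assms by simp
  also have "\<dots> \<le> (\<Sum>a\<in>A. ennreal (f (h a)))"
    using assms by (intro sum_image_le[where f=h and g="\<lambda>U. ennreal (f U)", simplified comp_def]) auto
  also have "\<dots> = ennreal (\<Sum>a\<in>A. f (h a))" using assms by (intro sum_ennreal) auto
  finally show ?thesis .
qed

text \<open>
  Take a finite \<open>r\<close>-net \<open>X\<close> of \<open>E\<close> and saturate it under the constraints that the ball of radius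
  \<open>\<rho> = 2 ^ k * r\<close> around a point of \<open>X\<close> has mass at most \<open>\<rho> powr s\<close>. Every point lies in a
  saturated ball, so by the Vitali covering lemma disjoint saturated balls, enlarged five times, cover \<open>X\<close>;
  enlarged six times, they cover \<open>E\<close>. The sum of the diameters to the power \<open>s\<close> is then at
  most \<open>12 powr s\<close> times the total mass, which therefore cannot be small if economical covers
  do not exist. Radii are restricted by \<open>12 * \<rho> \<le> \<delta>\<close> to make this cover admissible; for larger radii
  the bound holds because the mass of a ball is at most one.
\<close>
lemma discrete_frostman:
  fixes E :: "'a::euclidean_space set"
  assumes E: "bounded E" "E \<noteq> {}" and s: "0 \<le> s" and \<epsilon>: "0 < \<epsilon>"
    and r: "0 < r" and \<delta>: "\<delta> \<le> 1" "r \<le> \<delta>" "r = \<delta> powr (1 / \<theta>)"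
    and no: "\<nexists>\<U>. intermediate_cover \<theta> s \<epsilon> \<delta> E \<U>"
  obtains X :: "'a set" and w :: "'a \<Rightarrow> real"
  where "finite X" "X \<subseteq> E" "\<forall>x. 0 \<le> w x" "sum w X = 1"
    "\<forall>x\<in>X. \<forall>k. sum w (X \<inter> cball x (2 ^ k * r)) \<le> 12 powr s * max 1 (1 / \<epsilon>) * (2 ^ k * r / \<delta>) powr s"
proof -
  let ?C = "12 powr s * max 1 (1 / \<epsilon>)"
  have d0: "0 < \<delta>" using r \<delta> by linarith
  show ?thesis
  proof (cases "12 * r \<le> \<delta>")
    case False
    \<comment> \<open>No radius is admissible, but then the bound is at least one at every scale and a point mass will do.\<close>
    obtain x where x: "x \<in> E" using E by blast
    have bnd: "1 \<le> ?C * (2 ^ k * r / \<delta>) powr s" for k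
    proof -
      have "1 * (12 * r / \<delta>) \<le> 2 ^ k * (12 * r / \<delta>)"
        using r d0 by (intro mult_right_mono) auto
      moreover have "1 \<le> 12 * r / \<delta>" using False d0 by (simp add: field_simps)
      ultimately have "1 \<le> 12 * (2 ^ k * r / \<delta>)" by (simp add: mult_ac)
      then have "1 powr s \<le> (12 * (2 ^ k * r / \<delta>)) powr s" using s by (intro powr_mono2) auto
      also have "\<dots> = 12 powr s * (2 ^ k * r / \<delta>) powr s" using r d0 by (intro powr_mult)
      also have "\<dots> \<le> ?C * (2 ^ k * r / \<delta>) powr s" by (intro mult_right_mono) (auto simp: mult_le_cancel_left1)
      finally show ?thesis by simp
    qed
    have "{x} \<inter> cball x (2 ^ k * r) = {x}" for k using r by auto
    then show ?thesis
      by (intro that[of "{x}" "\<lambda>_. 1"]) (use x bnd in auto)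
  next
    case True
    obtain X where X: "finite X" "X \<subseteq> E" "E \<subseteq> (\<Union>x\<in>X. ball x r)"
      using finite_net_exists[OF E(1) r] by metis
    obtain N where N: "\<delta> / r < 2 ^ N" using real_arch_pow[of 2 "\<delta> / r"] by auto
    define I where "I = {(x, k). x \<in> X \<and> k \<le> N \<and> 12 * (2 ^ k * r) \<le> \<delta>}"
    have "I \<subseteq> X \<times> {..N}" by (auto simp: I_def)
    then have finI: "finite I" using X(1) by (meson finite_SigmaI finite_atMost finite_subset)
    have inI: "(x, k) \<in> I" if "x \<in> X" "12 * (2 ^ k * r) \<le> \<delta>" for x k
    proof -
      have "2 ^ k * r \<le> \<delta>" 
      proof -
        have "0 \<le> 2 ^ k * r" using r by simp
        then show ?thesis using that(2) by linarith
      qed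
      then have "(2::real) ^ k \<le> \<delta> / r" using r by (simp add: field_simps)
      also have "\<dots> < 2 ^ N" by (rule N)
      finally have "k < N" by simp
      then show ?thesis using that by (simp add: I_def)
    qed
    define Q where "Q i = cball (fst i) (2 ^ snd i * r)" for i :: "'a \<times> nat"
    define c where "c i = (2 ^ snd i * r) powr s" for i :: "'a \<times> nat"
    obtain w where w: "\<And>x. 0 \<le> w x" "\<And>i. i \<in> I \<Longrightarrow> sum w (X \<inter> Q i) \<le> c i"
       "\<And>x. x \<in> X \<Longrightarrow> \<exists>i\<in>I. x \<in> Q i \<and> sum w (X \<inter> Q i) = c i"
    proof (rule saturated_weights_exist[OF X(1) finI, of c Q])
      show "0 \<le> c i" for i by (simp add: c_def)
      show "\<exists>i\<in>I. x \<in> Q i" if "x \<in> X" for x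
        using inI[of x 0] that True r by (intro bexI[of _ "(x, 0)"]) (auto simp: Q_def)
    qed blast
    define S where "S = {i \<in> I. sum w (X \<inter> Q i) = c i}"
    have SI: "S \<subseteq> I" by (auto simp: S_def)
    have XS: "X \<subseteq> (\<Union>i\<in>S. cball (fst i) (2 ^ snd i * r))"
      using w(3) unfolding S_def Q_def by blast
    have rad: "0 < 2 ^ snd i * r \<and> 2 ^ snd i * r \<le> \<delta>" if "i \<in> S" for i
    proof -
      have "0 < 2 ^ snd i * r" using r by simp
      moreover have "12 * (2 ^ snd i * r) \<le> \<delta>" using that SI unfolding I_def by auto
      ultimately show ?thesis by linarith
    qed
    obtain D where "countable D" and D: "D \<subseteq> S"
      "pairwise (\<lambda>i j. disjnt (cball (fst i) (2 ^ snd i * r)) (cball (fst j) (2 ^ snd j * r))) D"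
      "X \<subseteq> (\<Union>i\<in>D. cball (fst i) (5 * (2 ^ snd i * r)))"
      by (rule Vitali_covering_lemma_cballs[OF XS rad])
    have finD: "finite D" using D(1) SI finI by (meson finite_subset)
    define U where "U i = cball (fst i) (6 * (2 ^ snd i * r))" for i :: "'a \<times> nat"
    have diamU: "diameter (U i) = 12 * (2 ^ snd i * r)" for i
    proof -
      have "0 \<le> 6 * (2 ^ snd i * r)" using r by simp
      then show ?thesis unfolding U_def diameter_cball by simp
    qed
    have Ucov: "E \<subseteq> \<Union>(U ` D)"
    proof
      fix y assume "y \<in> E"
      then obtain x where x: "x \<in> X" "dist x y < r" using X(3) by auto
      then obtain i where i: "i \<in> D" "dist (fst i) x \<le> 5 * (2 ^ snd i * r)" using D(3) by auto
      have "1 * r \<le> 2 ^ snd i * r" using r by (intro mult_right_mono) auto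
      then have "dist (fst i) y \<le> 6 * (2 ^ snd i * r)"
        using i(2) x(2) dist_triangle[of "fst i" y x] by linarith
      then show "y \<in> \<Union>(U ` D)" using i(1) by (auto simp: U_def)
    qed
    have Udiam: "bounded (U i) \<and> \<delta> powr (1 / \<theta>) \<le> diameter (U i) \<and> diameter (U i) \<le> \<delta>" if "i \<in> D" for i
    proof -
      have "1 * r \<le> 2 ^ snd i * r" using r by (intro mult_right_mono) auto
      then have "r \<le> 12 * (2 ^ snd i * r)" using r by linarith
      moreover have "12 * (2 ^ snd i * r) \<le> \<delta>" using that D(1) SI by (auto simp: I_def)
      ultimately show ?thesis unfolding diamU \<delta>(3)[symmetric] by (simp add: U_def)
    qed
    have "\<not> (\<Sum>\<^sub>\<infinity>V\<in>U ` D. ennreal (diameter V powr s)) \<le> ennreal \<epsilon>"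
      using no Ucov Udiam unfolding intermediate_cover_def by blast
    moreover have "(\<Sum>\<^sub>\<infinity>V\<in>U ` D. ennreal (diameter V powr s)) \<le> ennreal (\<Sum>i\<in>D. diameter (U i) powr s)"
      by (rule ennreal_infsum_image_le[OF finD]) simp
    ultimately have "\<epsilon> < (\<Sum>i\<in>D. diameter (U i) powr s)"
      by (meson ennreal_leI linorder_not_le order_trans)
    also have "\<dots> = 12 powr s * (\<Sum>i\<in>D. c i)"
      using r by (simp add: diamU c_def powr_mult sum_distrib_left)
    also have "(\<Sum>i\<in>D. c i) = (\<Sum>i\<in>D. sum w (X \<inter> Q i))"
      using D(1) by (intro sum.cong) (auto simp: S_def)
    also have "\<dots> = sum w (\<Union>i\<in>D. X \<inter> Q i)"
    proof (rule sum.UNION_disjoint[symmetric])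
      show "\<forall>i\<in>D. \<forall>j\<in>D. i \<noteq> j \<longrightarrow> X \<inter> Q i \<inter> (X \<inter> Q j) = {}"
        using D(2) unfolding pairwise_def disjnt_def Q_def by blast
    qed (use finD X in auto)
    also have "\<dots> \<le> sum w X" using X(1) w(1) by (intro sum_mono2) auto
    finally have W: "\<epsilon> < 12 powr s * sum w X" by simp
    define W where "W = sum w X"
    have W0: "0 < W" 
    proof (rule ccontr)
      assume "\<not> 0 < W"
      then have "12 powr s * W \<le> 0" by (intro mult_nonneg_nonpos) auto
      then show False using W \<epsilon> unfolding W_def by linarith
    qed
    have "1 / W \<le> 12 powr s / \<epsilon>" using W W0 \<epsilon> unfolding W_def by (simp add: field_simps)
    have d1: "a powr s \<le> (a / \<delta>) powr s" if "0 \<le> a" for a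
    proof (intro powr_mono2)
      have "\<delta> * a \<le> 1 * a" using that \<delta> by (intro mult_right_mono) auto
      then show "a \<le> a / \<delta>" using d0 by (simp add: field_simps)
    qed (use s that in auto)
    show ?thesis
    proof (rule that[of X "\<lambda>x. w x / W"])
      show "finite X" "X \<subseteq> E" by fact+
      show "\<forall>x. 0 \<le> w x / W" using w(1) W0 by simp
      show "(\<Sum>x\<in>X. w x / W) = 1" using W0 unfolding W_def by (simp flip: sum_divide_distrib)
      show "\<forall>x\<in>X. \<forall>k. (\<Sum>y\<in>X \<inter> cball x (2 ^ k * r). w y / W) \<le> ?C * (2 ^ k * r / \<delta>) powr s"
      proof (intro ballI allI)
        fix x k assume x: "x \<in> X"
        have sum_eq: "(\<Sum>y\<in>X \<inter> cball x (2 ^ k * r). w y / W) = sum w (X \<inter> cball x (2 ^ k * r)) / W"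
          by (simp add: sum_divide_distrib)
        show "(\<Sum>y\<in>X \<inter> cball x (2 ^ k * r). w y / W) \<le> ?C * (2 ^ k * r / \<delta>) powr s"
        proof (cases "12 * (2 ^ k * r) \<le> \<delta>")
          case True
          have "sum w (X \<inter> cball x (2 ^ k * r)) / W \<le> (2 ^ k * r) powr s / W"
            using w(2)[OF inI[OF x True]] W0 by (simp add: Q_def c_def divide_right_mono)
          also have "\<dots> = (1 / W) * (2 ^ k * r) powr s" by simp
          also have "\<dots> \<le> (12 powr s / \<epsilon>) * (2 ^ k * r) powr s"
            using \<open>1 / W \<le> 12 powr s / \<epsilon>\<close> by (intro mult_right_mono) auto
          also have "\<dots> \<le> (12 powr s / \<epsilon>) * (2 ^ k * r / \<delta>) powr s"
            using d1 r \<epsilon> by (intro mult_left_mono) auto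
          also have "\<dots> = 12 powr s * (1 / \<epsilon>) * (2 ^ k * r / \<delta>) powr s" by simp
          also have "\<dots> \<le> ?C * (2 ^ k * r / \<delta>) powr s"
            by (intro mult_right_mono mult_left_mono) auto
          finally show ?thesis using sum_eq by simp
        next
          case False
          have "sum w (X \<inter> cball x (2 ^ k * r)) \<le> W"
            unfolding W_def using X(1) w(1) by (intro sum_mono2) auto
          then have "sum w (X \<inter> cball x (2 ^ k * r)) / W \<le> 1" using W0 by simp
          also have "1 = 1 powr s" by simp
          also have "\<dots> \<le> (12 * (2 ^ k * r / \<delta>)) powr s"
            using False d0 s by (intro powr_mono2) (auto simp: field_simps)
          also have "\<dots> = 12 powr s * (2 ^ k * r / \<delta>) powr s" using r d0 by (intro powr_mult)
          also have "\<dots> \<le> ?C * (2 ^ k * r / \<delta>) powr s"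
            by (intro mult_right_mono) (auto simp: mult_le_cancel_left1)
          finally show ?thesis using sum_eq by simp
        qed
      qed
    qed
  qed
qed

section \<open>Energies of discrete measures under random projections\<close>

text \<open>
  For a probability vector \<open>w\<close> this is the probability that two independent points have images at
  distance at most \<open>r\<close>.
\<close>
definition discrete_energy :: "'a set \<Rightarrow> ('a \<Rightarrow> real) \<Rightarrow> ('a \<Rightarrow> 'b::real_normed_vector) \<Rightarrow> real \<Rightarrow> real" where
  "discrete_energy X w f r = (\<Sum>x\<in>X. \<Sum>y\<in>X. w x * w y * of_bool (norm (f x - f y) \<le> r))"

text \<open>
  Assign each point to one member of an optimal cover that contains its image. Two points assigned to the
  same member have close images, so the energy is at least the sum of the squared masses of the
  classes, and Cauchy-Schwarz bounds that sum below by the inverse of the number of classes.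
\<close>
lemma covering_number_energy:
  fixes F :: "'b::euclidean_space set"
  assumes F: "bounded F" and r: "0 < r" and X: "finite X" and f: "f ` X \<subseteq> F"
    and w: "\<And>x. 0 \<le> w x" "sum w X = 1"
  shows "1 \<le> real (covering_number F r) * discrete_energy X w f r"
proof -
  obtain \<U> where U: "finite \<U>" "card \<U> = covering_number F r" "F \<subseteq> \<Union>\<U>"
    "\<forall>U\<in>\<U>. bounded U \<and> diameter U \<le> r"
    by (rule covering_number_witness[OF F r])
  have "\<forall>x\<in>X. \<exists>U\<in>\<U>. f x \<in> U" using f U(3) by blast
  then obtain u where u: "\<And>x. x \<in> X \<Longrightarrow> u x \<in> \<U> \<and> f x \<in> u x" by metis
  define a where "a U = (\<Sum>x\<in>X. w x * of_bool (u x = U))" for U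
  have "(\<Sum>U\<in>\<U>. a U) = (\<Sum>x\<in>X. \<Sum>U\<in>\<U>. w x * of_bool (u x = U))"
    unfolding a_def by (rule sum.swap)
  also have "\<dots> = sum w X"
    using u U(1) by (intro sum.cong) (auto simp: of_bool_def if_distrib[of "(*) _"] cong: if_cong)
  finally have "(\<Sum>U\<in>\<U>. a U) = 1" using w(2) by simp
  then have "1 \<le> (\<Sum>U\<in>\<U>. (a U)\<^sup>2) * real (card \<U>)"
    using sum_squared_le_sum_of_squares[of a \<U>] by simp
  also have "(\<Sum>U\<in>\<U>. (a U)\<^sup>2) \<le> discrete_energy X w f r"
  proof -
    have "(\<Sum>U\<in>\<U>. (a U)\<^sup>2)
        = (\<Sum>U\<in>\<U>. \<Sum>x\<in>X. \<Sum>y\<in>X. w x * w y * (of_bool (u x = U) * of_bool (u y = U)))"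
      unfolding a_def power2_eq_square sum_product by (simp add: mult_ac)
    also have "\<dots> = (\<Sum>x\<in>X. \<Sum>U\<in>\<U>. \<Sum>y\<in>X. w x * w y * (of_bool (u x = U) * of_bool (u y = U)))"
      by (rule sum.swap)
    also have "\<dots> = (\<Sum>x\<in>X. \<Sum>y\<in>X. \<Sum>U\<in>\<U>. w x * w y * (of_bool (u x = U) * of_bool (u y = U)))"
      by (intro sum.cong refl sum.swap)
    also have "\<dots> \<le> discrete_energy X w f r"
      unfolding discrete_energy_def
    proof (intro sum_mono)
      fix x y assume xy: "x \<in> X" "y \<in> X"
      have "(\<Sum>U\<in>\<U>. w x * w y * (of_bool (u x = U) * of_bool (u y = U)))
          = (\<Sum>U\<in>\<U>. if U = u x then w x * w y * of_bool (u y = u x) else 0)"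
        by (intro sum.cong) auto
      also have "\<dots> = w x * w y * of_bool (u y = u x)" using u[OF xy(1)] U(1) by simp
      also have "\<dots> \<le> w x * w y * of_bool (norm (f x - f y) \<le> r)"
      proof (intro mult_left_mono)
        show "of_bool (u y = u x) \<le> (of_bool (norm (f x - f y) \<le> r) :: real)"
          using u[OF xy(1)] u[OF xy(2)] U(4) diameter_bounded_bound[of "u x" "f x" "f y"]
          by (force simp: dist_norm)
      qed (use w in auto)
      finally show "(\<Sum>U\<in>\<U>. w x * w y * (of_bool (u x = U) * of_bool (u y = U)))
        \<le> w x * w y * of_bool (norm (f x - f y) \<le> r)" .
    qed
    finally show ?thesis .
  qed
  finally show ?thesis using U(2) by (simp add: mult.commute mult_right_mono)
qed

text \<open>
  The decay \<open>(r / norm z) ^ m\<close>, written as a sum over dyadic scales so that it can be integrated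
  against a measure of which only the masses of balls of radius \<open>2 ^ k * r\<close> are controlled. Only the
  first scale that reaches \<open>z\<close> is used.
\<close>
lemma slab_probability_dyadic:
  fixes \<gamma> :: "(real ^ 'd) set measure" and z :: "real ^ 'd"
  assumes \<gamma>: "grassmannian_haar m \<gamma>" and r: "0 < r" and z: "norm z \<le> 2 ^ K * r"
  shows "measure \<gamma> {V \<in> space \<gamma>. norm (orth_proj V z) \<le> r}
    \<le> max 1 (slab_const TYPE(real ^ 'd) m) * 2 ^ m
        * (\<Sum>k\<le>K. (1 / 2 ^ k) ^ m * of_bool (norm z \<le> 2 ^ k * r))"
proof -
  interpret prob_space \<gamma> by (rule grassmannian_haarD[OF \<gamma>])
  let ?c = "max 1 (slab_const TYPE(real ^ 'd) m)"
  define j where "j = (LEAST k. norm z \<le> 2 ^ k * r)"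
  have j: "norm z \<le> 2 ^ j * r" unfolding j_def using z by (rule LeastI)
  have jK: "j \<le> K" unfolding j_def using z by (rule Least_le)
  have "prob {V \<in> space \<gamma>. norm (orth_proj V z) \<le> r} \<le> ?c * 2 ^ m * ((1 / 2 ^ j) ^ m)"
  proof (cases j)
    case 0
    have "prob {V \<in> space \<gamma>. norm (orth_proj V z) \<le> r} \<le> 1" by simp
    also have "1 \<le> ?c * 2 ^ m" using mult_mono[of 1 ?c 1 "2 ^ m"] by simp
    finally show ?thesis using 0 by simp
  next
    case (Suc i)
    have far: "2 ^ i * r < norm z"
      using not_less_Least[of i "\<lambda>k. norm z \<le> 2 ^ k * r"] Suc unfolding j_def by auto
    have "1 * r \<le> 2 ^ i * r" using r by (intro mult_right_mono) auto
    then have rz: "r \<le> norm z" using far by linarith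
    have "r / norm z \<le> r / (2 ^ i * r)"
      using far rz r by (intro divide_left_mono mult_pos_pos) auto
    then have "r / norm z \<le> 1 / 2 ^ i" using r by simp
    then have "(r / norm z) ^ m \<le> (1 / 2 ^ i) ^ m" using r by (intro power_mono) auto
    then have "slab_const TYPE(real ^ 'd) m * (r / norm z) ^ m \<le> ?c * (1 / 2 ^ i) ^ m"
      using r by (intro mult_mono) auto
    also have "\<dots> = ?c * 2 ^ m * ((1 / 2 ^ j) ^ m)"
      using Suc by (simp add: power_divide power_mult_distrib)
    finally show ?thesis using grassmannian_haar_slab[OF \<gamma> r rz] by linarith
  qed
  also have "(1 / 2 ^ j :: real) ^ m = (1 / 2 ^ j) ^ m * of_bool (norm z \<le> 2 ^ j * r)" using j by simp
  also have "\<dots> \<le> (\<Sum>k\<le>K. (1 / 2 ^ k) ^ m * of_bool (norm z \<le> 2 ^ k * r))"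
    using jK by (intro member_le_sum) auto
  finally show ?thesis by (simp add: mult_left_mono)
qed

text \<open>
  Summing the dyadic bound against \<open>w\<close>, the scale \<open>2 ^ k * r\<close> contributes a multiple of
  \<open>2 powr (k * (s - m))\<close>. The series converges because \<open>s < m\<close>: this is where the
  dimension of the subspaces has to exceed the Frostman exponent.
\<close>
lemma expected_energy_le:
  fixes \<gamma> :: "(real ^ 'd) set measure" and X :: "(real ^ 'd) set"
  assumes \<gamma>: "grassmannian_haar m \<gamma>" and r: "0 < r" and \<delta>: "0 < \<delta>" and sm: "s < real m"
    and X: "finite X" and w: "\<And>x. 0 \<le> w x" "sum w X = 1" and A: "0 \<le> A"
    and frost: "\<And>x k. x \<in> X \<Longrightarrow> sum w (X \<inter> cball x (2 ^ k * r)) \<le> A * (2 ^ k * r / \<delta>) powr s"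
  defines "C \<equiv> max 1 (slab_const TYPE(real ^ 'd) m) * 2 ^ m / (1 - 2 powr (s - real m))"
  shows "integrable \<gamma> (\<lambda>V. discrete_energy X w (orth_proj V) r)"
    and "(\<integral>V. discrete_energy X w (orth_proj V) r \<partial>\<gamma>) \<le> C * A * (r / \<delta>) powr s"
proof -
  note h = grassmannian_haarD[OF \<gamma>]
  interpret prob_space \<gamma> by (rule h)
  let ?c = "max 1 (slab_const TYPE(real ^ 'd) m) * 2 ^ m"
  let ?S = "\<lambda>x y. {V \<in> space \<gamma>. norm (orth_proj V (x - y)) \<le> r}"
  have S: "?S x y \<in> sets \<gamma>" for x y
    using measurable_orth_proj[OF \<gamma>, of "x - y"] by measurable
  have eq: "discrete_energy X w (orth_proj V) r = (\<Sum>x\<in>X. \<Sum>y\<in>X. w x * w y * indicator (?S x y) V)"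
    if "V \<in> space \<gamma>" for V
    using that h(3) unfolding discrete_energy_def
    by (intro sum.cong) (auto simp: grassmannian_def linear_diff[OF linear_orth_proj])
  have int: "integrable \<gamma> (\<lambda>V. \<Sum>x\<in>X. \<Sum>y\<in>X. w x * w y * indicator (?S x y) V)"
    using S by (intro Bochner_Integration.integrable_sum integrable_mult_right) (auto simp: less_top[symmetric])
  then show "integrable \<gamma> (\<lambda>V. discrete_energy X w (orth_proj V) r)"
    using eq by (subst Bochner_Integration.integrable_cong[OF refl]) auto
  have "(\<integral>V. discrete_energy X w (orth_proj V) r \<partial>\<gamma>)
      = (\<integral>V. (\<Sum>x\<in>X. \<Sum>y\<in>X. w x * w y * indicator (?S x y) V) \<partial>\<gamma>)"
    using eq by (intro Bochner_Integration.integral_cong) auto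
  also have "\<dots> = (\<Sum>x\<in>X. \<integral>V. (\<Sum>y\<in>X. w x * w y * indicator (?S x y) V) \<partial>\<gamma>)"
    using S by (intro Bochner_Integration.integral_sum Bochner_Integration.integrable_sum integrable_mult_right) (auto simp: less_top[symmetric])
  also have "\<dots> = (\<Sum>x\<in>X. \<Sum>y\<in>X. \<integral>V. w x * w y * indicator (?S x y) V \<partial>\<gamma>)"
    using S by (intro sum.cong refl Bochner_Integration.integral_sum integrable_mult_right) (auto simp: less_top[symmetric])
  also have "\<dots> = (\<Sum>x\<in>X. w x * (\<Sum>y\<in>X. w y * prob (?S x y)))"
    using S by (simp add: sum_distrib_left mult.assoc)
  also have "\<dots> \<le> (\<Sum>x\<in>X. w x * (C * A * (r / \<delta>) powr s))"
  proof (intro sum_mono mult_left_mono)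
    fix x assume x: "x \<in> X"
    obtain K where K: "\<And>y. y \<in> X \<Longrightarrow> norm (x - y) \<le> 2 ^ K * r"
    proof -
      obtain K where K: "(\<Sum>y\<in>X. norm (x - y)) / r < 2 ^ K" using real_arch_pow[of 2] by auto
      have "norm (x - y) \<le> 2 ^ K * r" if "y \<in> X" for y
      proof -
        have "norm (x - y) \<le> (\<Sum>y\<in>X. norm (x - y))" using that X by (intro member_le_sum) auto
        then show ?thesis using K r by (simp add: field_simps)
      qed
      then show ?thesis using that by blast
    qed
    define t :: "nat \<Rightarrow> real ^ 'd \<Rightarrow> real"
      where "t k y = (1 / 2 ^ k) ^ m * of_bool (norm (x - y) \<le> 2 ^ k * r)" for k y
    have "(\<Sum>y\<in>X. w y * prob (?S x y)) \<le> (\<Sum>y\<in>X. w y * (?c * (\<Sum>k\<le>K. t k y)))"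
      using slab_probability_dyadic[OF \<gamma> r K, folded t_def] w(1) by (intro sum_mono mult_left_mono) auto
    also have "\<dots> = ?c * (\<Sum>y\<in>X. \<Sum>k\<le>K. w y * t k y)"
      by (simp add: sum_distrib_left mult_ac)
    also have "(\<Sum>y\<in>X. \<Sum>k\<le>K. w y * t k y) = (\<Sum>k\<le>K. \<Sum>y\<in>X. w y * t k y)"
      by (rule sum.swap)
    finally have dyadic: "(\<Sum>y\<in>X. w y * prob (?S x y)) \<le> ?c * (\<Sum>k\<le>K. \<Sum>y\<in>X. w y * t k y)" .
    have "(\<Sum>k\<le>K. \<Sum>y\<in>X. w y * t k y) \<le> (\<Sum>k\<le>K. A * (r / \<delta>) powr s * (2 powr (s - real m)) ^ k)"
    proof (rule sum_mono)
      fix k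
      have "(\<Sum>y\<in>X. w y * t k y) = (1 / 2 ^ k) ^ m * (\<Sum>y\<in>X. w y * of_bool (norm (x - y) \<le> 2 ^ k * r))"
        unfolding t_def sum_distrib_left by (intro sum.cong refl) (simp only: mult_ac)
      also have "(\<Sum>y\<in>X. w y * of_bool (norm (x - y) \<le> 2 ^ k * r)) = sum w (X \<inter> cball x (2 ^ k * r))"
        unfolding sum.inter_restrict[OF X] by (intro sum.cong refl) (simp add: dist_norm)
      also have "(1 / 2 ^ k) ^ m * sum w (X \<inter> cball x (2 ^ k * r))
          \<le> (1 / 2 ^ k) ^ m * (A * (2 ^ k * r / \<delta>) powr s)"
        using frost[OF x] by (intro mult_left_mono) auto
      also have "(2 ^ k * r / \<delta>) powr s = (2 ^ k) powr s * (r / \<delta>) powr s"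
        using r \<delta> powr_mult[of "2 ^ k" "r / \<delta>" s] by simp
      also have "(1 / 2 ^ k) ^ m * (A * ((2 ^ k) powr s * (r / \<delta>) powr s))
          = A * (r / \<delta>) powr s * ((1 / 2 ^ k) ^ m * (2 ^ k) powr s)" by (simp add: mult_ac)
      also have "(1 / 2 ^ k) ^ m * (2 ^ k) powr s = (2 powr (s - real m)) ^ k"
      proof -
        have "(1 / 2 ^ k) ^ m = (2::real) powr (- (real k * real m))"
          by (simp add: powr_minus powr_realpow[symmetric] powr_powr power_divide field_simps)
        moreover have "(2 ^ k) powr s = (2::real) powr (real k * s)"
          by (simp add: powr_realpow[symmetric] powr_powr)
        moreover have "(2 powr (s - real m)) ^ k = (2::real) powr (real k * (s - real m))"
          by (simp add: powr_realpow[symmetric] powr_powr mult.commute)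
        ultimately show ?thesis by (simp add: powr_add[symmetric] algebra_simps)
      qed
      finally show "(\<Sum>y\<in>X. w y * t k y) \<le> A * (r / \<delta>) powr s * (2 powr (s - real m)) ^ k" .
    qed
    also have "\<dots> = A * (r / \<delta>) powr s * (\<Sum>k\<le>K. (2 powr (s - real m)) ^ k)"
      by (simp add: sum_distrib_left)
    also have "\<dots> \<le> A * (r / \<delta>) powr s * (1 / (1 - 2 powr (s - real m)))"
    proof (rule mult_left_mono)
      have q: "2 powr (s - real m) < 1" using sm by (simp add: powr_less_one)
      then have "(\<Sum>k\<le>K. (2 powr (s - real m)) ^ k) \<le> (\<Sum>k. (2 powr (s - real m)) ^ k)"
        by (intro sum_le_suminf summable_geometric) auto
      also have "\<dots> = 1 / (1 - 2 powr (s - real m))" using q by (intro suminf_geometric) auto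
      finally show "(\<Sum>k\<le>K. (2 powr (s - real m)) ^ k) \<le> 1 / (1 - 2 powr (s - real m))" .
    qed (use A in auto)
    finally have "?c * (\<Sum>k\<le>K. \<Sum>y\<in>X. w y * t k y)
        \<le> ?c * (A * (r / \<delta>) powr s * (1 / (1 - 2 powr (s - real m))))"
      by (rule mult_left_mono) simp
    also have "\<dots> = C * A * (r / \<delta>) powr s" by (simp add: C_def mult_ac)
    finally show "(\<Sum>y\<in>X. w y * prob (?S x y)) \<le> C * A * (r / \<delta>) powr s"
      using dyadic by linarith
  qed (use w in auto)
  also have "\<dots> = C * A * (r / \<delta>) powr s"
    using w(2) by (simp flip: sum_distrib_right)
  finally show "(\<integral>V. discrete_energy X w (orth_proj V) r \<partial>\<gamma>) \<le> C * A * (r / \<delta>) powr s" .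
qed

text \<open>
  Markov's inequality for the energy. The constant does not depend on \<open>r\<close>, as is needed to sum
  over scales.
\<close>
lemma exceptional_subspaces:
  fixes \<gamma> :: "(real ^ 'd) set measure" and E :: "(real ^ 'd) set"
  assumes \<gamma>: "grassmannian_haar m \<gamma>" and E: "bounded E" "E \<noteq> {}"
    and s: "0 \<le> s" "s < real m" and \<epsilon>: "0 < \<epsilon>" and \<theta>: "0 < \<theta>" "\<theta> \<le> 1"
  shows "\<exists>C. \<forall>r. 0 < r \<longrightarrow> r \<le> 1 \<longrightarrow> (\<nexists>\<U>. intermediate_cover \<theta> s \<epsilon> (r powr \<theta>) E \<U>) \<longrightarrow>
      (\<exists>S\<in>sets \<gamma>. measure \<gamma> S \<le> C * r powr \<eta> \<and>
        (\<forall>V\<in>space \<gamma> - S. r powr (\<eta> - (1 - \<theta>) * s) \<le> real (covering_number (orth_proj V ` E) r)))"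
proof -
  note h = grassmannian_haarD[OF \<gamma>]
  interpret prob_space \<gamma> by (rule h)
  define A where "A = 12 powr s * max 1 (1 / \<epsilon>)"
  define B where "B = max 1 (slab_const TYPE(real ^ 'd) m) * 2 ^ m / (1 - 2 powr (s - real m))"
  have A0: "0 \<le> A" unfolding A_def by auto
  show ?thesis
  proof (intro exI[of _ "B * A"] allI impI)
    fix r :: real assume r: "0 < r" "r \<le> 1" and no: "\<nexists>\<U>. intermediate_cover \<theta> s \<epsilon> (r powr \<theta>) E \<U>"
    define \<delta> where "\<delta> = r powr \<theta>"
    have \<delta>: "0 < \<delta>" "\<delta> \<le> 1" "r \<le> \<delta>" "r = \<delta> powr (1 / \<theta>)"
      using r \<theta> powr_mono'[of \<theta> 1 r] by (auto simp: \<delta>_def powr_powr powr_le1)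
    have no': "\<nexists>\<U>. intermediate_cover \<theta> s \<epsilon> \<delta> E \<U>" using no unfolding \<delta>_def .
    obtain X w where X: "finite X" "X \<subseteq> E" and w': "\<forall>x. 0 \<le> w x" "sum w X = 1"
      and frost': "\<forall>x\<in>X. \<forall>k. sum w (X \<inter> cball x (2 ^ k * r)) \<le> A * (2 ^ k * r / \<delta>) powr s"
      unfolding A_def by (rule discrete_frostman[OF E s(1) \<epsilon> r(1) \<delta>(2-4) no'])
    have w: "\<And>x. 0 \<le> w x" "sum w X = 1" using w' by simp_all
    have frost: "\<And>x k. x \<in> X \<Longrightarrow> sum w (X \<inter> cball x (2 ^ k * r)) \<le> A * (2 ^ k * r / \<delta>) powr s"
      using frost' by simp
    let ?J = "\<lambda>V. discrete_energy X w (orth_proj V) r"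
    note J = expected_energy_le[OF \<gamma> r(1) \<delta>(1) s(2) X(1) w A0 frost, folded B_def]
    have J0: "0 \<le> ?J V" for V
      unfolding discrete_energy_def using w by (intro sum_nonneg) auto
    define c where "c = r powr ((1 - \<theta>) * s - \<eta>)"
    have c0: "0 < c" using r by (simp add: c_def)
    define S where "S = {V \<in> space \<gamma>. c \<le> ?J V}"
    have Jm: "?J \<in> borel_measurable \<gamma>" using J(1) by blast
    have S: "S \<in> sets \<gamma>" unfolding S_def using Jm by measurable
    have "measure \<gamma> S \<le> (\<integral>V. ?J V \<partial>\<gamma>) / c"
      unfolding S_def by (rule integral_Markov_inequality_measure[where A = "{}"]) (use J J0 c0 in auto)
    also have "\<dots> \<le> B * A * (r / \<delta>) powr s / c"
      using J(2) c0 by (intro divide_right_mono) auto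
    also have "(r / \<delta>) powr s = r powr ((1 - \<theta>) * s)"
    proof -
      have "r / \<delta> = r powr (1 - \<theta>)" using r by (simp add: \<delta>_def powr_diff)
      then show ?thesis by (simp add: powr_powr)
    qed
    also have "B * A * r powr ((1 - \<theta>) * s) / c = B * A * r powr \<eta>"
      using r by (simp add: c_def powr_diff)
    finally have mS: "measure \<gamma> S \<le> B * A * r powr \<eta>" .
    have big: "r powr (\<eta> - (1 - \<theta>) * s) \<le> real (covering_number (orth_proj V ` E) r)"
      if V: "V \<in> space \<gamma> - S" for V
    proof -
      have "bounded (orth_proj V ` E)"
        using V h(3) E(1) by (auto simp: grassmannian_def intro: bounded_orth_proj_image)
      from covering_number_energy[OF this r(1) X(1) _ w, of "orth_proj V"] X(2)
      have "1 \<le> real (covering_number (orth_proj V ` E) r) * ?J V" by blast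
      also have "\<dots> \<le> real (covering_number (orth_proj V ` E) r) * c"
        using V by (intro mult_left_mono) (auto simp: S_def)
      finally have "1 / c \<le> real (covering_number (orth_proj V ` E) r)"
        using c0 by (simp add: field_simps)
      moreover have "1 / c = r powr (\<eta> - (1 - \<theta>) * s)"
        using r by (simp add: c_def powr_minus_divide[symmetric])
      ultimately show ?thesis by simp
    qed
    show "\<exists>S\<in>sets \<gamma>. measure \<gamma> S \<le> B * A * r powr \<eta> \<and>
        (\<forall>V\<in>space \<gamma> - S. r powr (\<eta> - (1 - \<theta>) * s) \<le> real (covering_number (orth_proj V ` E) r))"
      using S mS big by blast
  qed
qed

text \<open>
  The bound \<open>\<rho> k \<le> (1/2) ^ k\<close> makes the exceptional probabilities \<open>C * \<rho> k powr \<eta>\<close> summable, so the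
  Borel-Cantelli lemma applies.
\<close>
lemma AE_eventually_covering_number_ge:
  fixes \<gamma> :: "(real ^ 'd) set measure" and E :: "(real ^ 'd) set" and \<rho> :: "nat \<Rightarrow> real"
  assumes \<gamma>: "grassmannian_haar m \<gamma>" and E: "bounded E" "E \<noteq> {}"
    and s: "0 \<le> s" "s < real m" and \<epsilon>: "0 < \<epsilon>" and \<theta>: "0 < \<theta>" "\<theta> \<le> 1" and \<eta>: "0 < \<eta>"
    and \<rho>: "\<And>k. 0 < \<rho> k" "\<And>k. \<rho> k \<le> (1/2) ^ k"
    and no: "\<forall>\<^sub>F k in sequentially. \<nexists>\<U>. intermediate_cover \<theta> s \<epsilon> (\<rho> k powr \<theta>) E \<U>"
  shows "AE V in \<gamma>. \<forall>\<^sub>F k in sequentially.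
    \<rho> k powr (\<eta> - (1 - \<theta>) * s) \<le> real (covering_number (orth_proj V ` E) (\<rho> k))"
proof -
  note h = grassmannian_haarD[OF \<gamma>]
  interpret prob_space \<gamma> by (rule h)
  obtain C where C: "\<forall>r. 0 < r \<longrightarrow> r \<le> 1 \<longrightarrow> (\<nexists>\<U>. intermediate_cover \<theta> s \<epsilon> (r powr \<theta>) E \<U>) \<longrightarrow>
      (\<exists>S\<in>sets \<gamma>. measure \<gamma> S \<le> C * r powr \<eta> \<and>
        (\<forall>V\<in>space \<gamma> - S. r powr (\<eta> - (1 - \<theta>) * s) \<le> real (covering_number (orth_proj V ` E) r)))"
    using exceptional_subspaces[OF \<gamma> E s \<epsilon> \<theta>, of \<eta>] by (elim exE)
  obtain k0 where k0: "\<And>k. k0 \<le> k \<Longrightarrow> \<nexists>\<U>. intermediate_cover \<theta> s \<epsilon> (\<rho> k powr \<theta>) E \<U>"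
    using no unfolding eventually_sequentially by auto
  have \<rho>1: "\<rho> k \<le> 1" for k
    using \<rho>(2)[of k] power_le_one[of "1/2::real" k] by simp
  have "\<exists>S. S \<in> sets \<gamma> \<and> (k0 \<le> k \<longrightarrow> measure \<gamma> S \<le> C * \<rho> k powr \<eta> \<and>
        (\<forall>V\<in>space \<gamma> - S. \<rho> k powr (\<eta> - (1 - \<theta>) * s) \<le> real (covering_number (orth_proj V ` E) (\<rho> k))))" for k
  proof (cases "k0 \<le> k")
    case True
    from C[rule_format, OF \<rho>(1) \<rho>1 k0[OF True]] show ?thesis
      unfolding Bex_def using True by simp
  qed auto
  then have "\<exists>S. \<forall>k. S k \<in> sets \<gamma> \<and> (k0 \<le> k \<longrightarrow> measure \<gamma> (S k) \<le> C * \<rho> k powr \<eta> \<and>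
        (\<forall>V\<in>space \<gamma> - S k. \<rho> k powr (\<eta> - (1 - \<theta>) * s) \<le> real (covering_number (orth_proj V ` E) (\<rho> k))))"
    by (intro choice allI)
  then obtain S where S: "\<And>k. S k \<in> sets \<gamma>" "\<And>k. k0 \<le> k \<Longrightarrow> measure \<gamma> (S k) \<le> C * \<rho> k powr \<eta>"
    "\<And>k V. k0 \<le> k \<Longrightarrow> V \<in> space \<gamma> - S k \<Longrightarrow>
      \<rho> k powr (\<eta> - (1 - \<theta>) * s) \<le> real (covering_number (orth_proj V ` E) (\<rho> k))" by auto
  have "summable (\<lambda>k. measure \<gamma> (S k))"
  proof (rule summable_comparison_test')
    let ?q = "(1/2) powr \<eta> :: real"
    have "?q < 1" using \<eta> powr_less_mono'[of "1/2" 0 \<eta>] by simp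
    then show "summable (\<lambda>k. \<bar>C\<bar> * ?q ^ k)" by (intro summable_mult summable_geometric) simp
    fix k assume k: "k0 \<le> k"
    have "\<rho> k powr \<eta> \<le> ((1/2) ^ k) powr \<eta>"
      using \<rho>(1)[of k] \<rho>(2)[of k] \<eta> by (intro powr_mono2) auto
    also have "\<dots> = ?q ^ k"
      by (simp add: powr_realpow[symmetric] powr_powr mult.commute)
    finally have "\<bar>C\<bar> * \<rho> k powr \<eta> \<le> \<bar>C\<bar> * ?q ^ k" by (intro mult_left_mono) auto
    moreover have "C * \<rho> k powr \<eta> \<le> \<bar>C\<bar> * \<rho> k powr \<eta>" by (intro mult_right_mono) auto
    ultimately show "norm (measure \<gamma> (S k)) \<le> \<bar>C\<bar> * ?q ^ k" using S(2)[OF k] by simp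
  qed
  then have "AE V in \<gamma>. \<forall>\<^sub>F k in sequentially. V \<in> space \<gamma> - S k"
    using S(1) by (intro borel_cantelli_AE1) (auto simp: less_top[symmetric])
  then show ?thesis
  proof (rule AE_mp, intro AE_I2 impI)
    fix V assume "\<forall>\<^sub>F k in sequentially. V \<in> space \<gamma> - S k"
    then show "\<forall>\<^sub>F k in sequentially.
      \<rho> k powr (\<eta> - (1 - \<theta>) * s) \<le> real (covering_number (orth_proj V ` E) (\<rho> k))"
      using eventually_ge_at_top[of k0] by eventually_elim (use S(3) in blast)
  qed
qed

section \<open>Covering projections of sets with efficient covers\<close>

text \<open>
  Cut \<open>V\<close> into cubes of side \<open>r / dim V\<close> along an orthonormal basis. The diameter of a cube is at most the
  sum of its \<open>dim V\<close> sides, that is, \<open>r\<close>.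
\<close>
lemma subspace_set_cover:
  fixes A V :: "'a::euclidean_space set"
  assumes V: "subspace V" and A: "A \<subseteq> V" and D: "\<And>x y. x \<in> A \<Longrightarrow> y \<in> A \<Longrightarrow> dist x y \<le> D"
    and r: "0 < r" "r \<le> D"
  obtains \<U> where "finite \<U>" "real (card \<U>) \<le> ((2 * real (dim V) + 3) * (D / r)) ^ dim V"
    "A \<subseteq> \<Union>\<U>" "\<forall>U\<in>\<U>. bounded U \<and> diameter U \<le> r"
proof -
  obtain B where B: "B \<subseteq> V" "pairwise orthogonal B" "\<And>x. x \<in> B \<Longrightarrow> norm x = 1"
    "independent B" "card B = dim V" "span B = V"
    using orthonormal_basis_subspace[OF V] by metis
  have finB: "finite B" using B(4) by (rule independent_imp_finite)
  define p where "p = real (dim V)"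
  have p0: "0 \<le> p" by (simp add: p_def)
  show ?thesis
  proof (cases "A = {}")
    case True
    then show ?thesis using r by (intro that[of "{}"]) auto
  next
    case False
    then obtain a where a: "a \<in> A" by blast
    define q where "q x b = \<lfloor>p * ((x - a) \<bullet> b) / r\<rfloor>" for x b
    define n where "n = nat \<lceil>p * D / r\<rceil>"
    define K where "K = PiE B (\<lambda>_. {- int n..int n})"
    define cell where "cell k = {x \<in> A. \<forall>b\<in>B. q x b = k b}" for k :: "'a \<Rightarrow> int"
    have finK: "finite K" unfolding K_def using finB by (intro finite_PiE) auto
    have n: "real n \<le> p * D / r + 1"
      using p0 r unfolding n_def by (simp add: of_nat_nat)
    have card: "real (card (cell ` K)) \<le> ((2 * p + 3) * (D / r)) ^ dim V"
    proof -
      have "card (cell ` K) \<le> card K" using finK by (rule card_image_le)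
      also have "card K = (2 * n + 1) ^ dim V"
      proof -
        have "card {- int n..int n} = 2 * n + 1" by simp
        then show ?thesis unfolding K_def using finB B(5) by (simp add: card_PiE)
      qed
      finally have "card (cell ` K) \<le> (2 * n + 1) ^ dim V" .
      then have "real (card (cell ` K)) \<le> real ((2 * n + 1) ^ dim V)" by (rule of_nat_mono)
      also have "\<dots> = (2 * real n + 1) ^ dim V" by (simp add: add.commute)
      also have "\<dots> \<le> ((2 * p + 3) * (D / r)) ^ dim V"
      proof (rule power_mono)
        have "1 \<le> D / r" using r by simp
        have "2 * real n + 1 \<le> 2 * (p * D / r + 1) + 1" using n by simp
        also have "\<dots> \<le> 2 * (p * D / r) + 3 * (D / r)" using \<open>1 \<le> D / r\<close> by simp
        also have "\<dots> = (2 * p + 3) * (D / r)" by (simp add: algebra_simps)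
        finally show "2 * real n + 1 \<le> (2 * p + 3) * (D / r)" .
      qed simp
      finally show ?thesis .
    qed
    have cov: "A \<subseteq> \<Union>(cell ` K)"
    proof
      fix x assume x: "x \<in> A"
      have "q x b \<in> {- int n..int n}" if b: "b \<in> B" for b
      proof -
        have "\<bar>(x - a) \<bullet> b\<bar> \<le> norm (x - a) * norm b" by (rule Cauchy_Schwarz_ineq2)
        also have "\<dots> \<le> D" using D[OF x a] B(3)[OF b] by (simp add: dist_norm)
        finally have "p * \<bar>(x - a) \<bullet> b\<bar> \<le> p * D" using p0 by (rule mult_left_mono)
        then have "\<bar>p * ((x - a) \<bullet> b)\<bar> \<le> p * D" using p0 by (simp add: abs_mult)
        then have "- (p * D) \<le> p * ((x - a) \<bullet> b)" "p * ((x - a) \<bullet> b) \<le> p * D" by linarith+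
        then have "- (p * D) / r \<le> p * ((x - a) \<bullet> b) / r" "p * ((x - a) \<bullet> b) / r \<le> p * D / r"
          using r by (simp_all only: divide_right_mono less_imp_le)
        then have "- (p * D / r) \<le> p * ((x - a) \<bullet> b) / r" "p * ((x - a) \<bullet> b) / r \<le> p * D / r"
          by simp_all
        then show ?thesis unfolding q_def n_def by simp linarith
      qed
      then have "restrict (q x) B \<in> K" unfolding K_def by auto
      moreover have "x \<in> cell (restrict (q x) B)" using x by (simp add: cell_def)
      ultimately show "x \<in> \<Union>(cell ` K)" by blast
    qed
    have small: "dist x y \<le> r" if xy: "x \<in> cell k" "y \<in> cell k" for k x y
    proof (cases "dim V = 0")
      case True
      then have "V \<subseteq> {0}" by simp
      moreover have "x \<in> V" "y \<in> V" using xy A unfolding cell_def by auto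
      ultimately have "x = 0" "y = 0" by auto
      then show ?thesis using r by simp
    next
      case False
      then have p: "0 < p" unfolding p_def by (simp only: of_nat_0_less_iff neq0_conv)
      have coord: "\<bar>(x - y) \<bullet> b\<bar> \<le> r / p" if b: "b \<in> B" for b
      proof -
        have "q x b = q y b" using xy b by (simp add: cell_def)
        then have "\<bar>p * ((x - a) \<bullet> b) / r - p * ((y - a) \<bullet> b) / r\<bar> \<le> 1"
          unfolding q_def by linarith
        also have "p * ((x - a) \<bullet> b) / r - p * ((y - a) \<bullet> b) / r = p / r * ((x - y) \<bullet> b)"
          by (simp add: inner_diff_left algebra_simps diff_divide_distrib)
        finally have "p / r * \<bar>(x - y) \<bullet> b\<bar> \<le> 1" using p r by (simp add: abs_mult)
        then show ?thesis using p r by (simp add: field_simps)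
      qed
      have "x - y \<in> span B" using xy A B(6) V by (auto simp: cell_def intro: subspace_diff)
      then have "x - y = (\<Sum>b\<in>B. ((x - y) \<bullet> b) *\<^sub>R b)"
        using orthonormal_basis_expand[OF B(2) B(3) _ finB, of "x - y"] by simp
      then have "norm (x - y) = norm (\<Sum>b\<in>B. ((x - y) \<bullet> b) *\<^sub>R b)" by (rule arg_cong)
      also have "\<dots> \<le> (\<Sum>b\<in>B. norm (((x - y) \<bullet> b) *\<^sub>R b))" by (rule norm_sum)
      also have "\<dots> \<le> (\<Sum>b\<in>B. r / p)" using coord B(3) by (intro sum_mono) simp
      also have "\<dots> = r" using p unfolding sum_constant B(5) p_def[symmetric] by simp
      finally show ?thesis by (simp add: dist_norm)
    qed
    have bA: "bounded A" using D[OF a] unfolding bounded_def by blast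
    have "bounded (cell k) \<and> diameter (cell k) \<le> r" for k
    proof
      show "bounded (cell k)" by (rule bounded_subset[OF bA]) (auto simp: cell_def)
      show "diameter (cell k) \<le> r" by (rule diameter_le) (use small r in \<open>auto simp: dist_norm\<close>)
    qed
    then show ?thesis
      using finK card cov by (intro that[of "cell ` K"]) (auto simp: p_def)
  qed
qed

lemma power_ratio:
  fixes x r c :: real
  assumes "0 < x" "0 < r"
  shows "(c * (x / r)) ^ m = c ^ m * r powr (- real m) * x powr real m"
  using assms by (simp add: power_mult_distrib power_divide powr_minus powr_realpow divide_inverse power_inverse mult_ac)

text \<open>
  All members have a diameter bounded away from zero, so that a cover with infinitely many members
  would have an infinite sum.
\<close>
lemma intermediate_cover_finite_sum:
  assumes c: "intermediate_cover \<theta> s 1 \<delta> F \<U>" and \<delta>: "0 < \<delta>" and s: "0 \<le> s"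
  shows "finite \<U>" and "(\<Sum>U\<in>\<U>. diameter U powr s) \<le> 1"
proof -
  have diam: "\<delta> powr (1 / \<theta>) \<le> diameter U" if "U \<in> \<U>" for U
    using c that unfolding intermediate_cover_def by blast
  have sum: "(\<Sum>\<^sub>\<infinity>U\<in>\<U>. ennreal (diameter U powr s)) \<le> ennreal 1"
    using c unfolding intermediate_cover_def by blast
  have part: "(\<Sum>U\<in>W. diameter U powr s) \<le> 1" if W: "finite W" "W \<subseteq> \<U>" for W
  proof -
    have "ennreal (\<Sum>U\<in>W. diameter U powr s) = (\<Sum>U\<in>W. ennreal (diameter U powr s))"
      by (rule sum_ennreal[symmetric]) simp
    also have "\<dots> = (\<Sum>\<^sub>\<infinity>U\<in>W. ennreal (diameter U powr s))" using W(1) by simp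
    also have "\<dots> \<le> (\<Sum>\<^sub>\<infinity>U\<in>\<U>. ennreal (diameter U powr s))"
      using W(2) by (intro infsum_mono_neutral) (auto intro: nonneg_summable_on_complete)
    also have "\<dots> \<le> ennreal 1" by (rule sum)
    finally show ?thesis by (simp add: sum_nonneg)
  qed
  show fin: "finite \<U>"
  proof (rule ccontr)
    assume inf: "infinite \<U>"
    define e where "e = (\<delta> powr (1 / \<theta>)) powr s"
    have e: "0 < e" using \<delta> by (simp add: e_def)
    obtain n where n: "1 / e < real n" using reals_Archimedean2 by blast
    obtain W where W: "finite W" "card W = n" "W \<subseteq> \<U>"
      using infinite_arbitrarily_large[OF inf, of n] by blast
    have "real n * e = (\<Sum>U\<in>W. e)" using W(2) by simp
    also have "\<dots> \<le> (\<Sum>U\<in>W. diameter U powr s)"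
      unfolding e_def using W(3) diam s by (intro sum_mono powr_mono2) auto
    also have "\<dots> \<le> 1" using W by (intro part)
    finally show False using n e by (simp add: field_simps)
  qed
  show "(\<Sum>U\<in>\<U>. diameter U powr s) \<le> 1" using fin by (intro part) auto
qed

text \<open>
  Each member \<open>U\<close> projects to a set of diameter at most \<open>diameter U\<close> in \<open>V\<close>, which splits into
  \<open>C * (diameter U / r) ^ m\<close> cells. Since \<open>diameter U \<le> \<delta>\<close> and \<open>s \<le> m\<close>, replacing the
  exponent \<open>m\<close> of \<open>diameter U\<close> by \<open>s\<close> gains a factor \<open>\<delta> powr (m - s) = r powr (\<theta> * (m - s))\<close>.
\<close>
lemma covering_number_projection_le:
  fixes F V :: "'a::euclidean_space set"
  assumes V: "subspace V" "dim V = m" and \<delta>: "0 < \<delta>" and \<theta>: "0 < \<theta>"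
    and s: "0 \<le> s" "s \<le> real m" and c: "intermediate_cover \<theta> s 1 \<delta> F \<U>"
  defines "r \<equiv> \<delta> powr (1 / \<theta>)"
  shows "real (covering_number (orth_proj V ` F) r)
    \<le> (2 * real m + 3) ^ m * r powr (- (real m - \<theta> * (real m - s)))"
proof -
  have r0: "0 < r" using \<delta> by (simp add: r_def)
  note fin = intermediate_cover_finite_sum[OF c \<delta> s(1)]
  have lin: "linear (orth_proj V)" using V(1) by (rule linear_orth_proj)
  have dU: "bounded U" "r \<le> diameter U" "diameter U \<le> \<delta>" if "U \<in> \<U>" for U
    using c that unfolding intermediate_cover_def r_def by blast+
  let ?c = "2 * real m + 3"
  have "\<exists>W. finite W \<and> real (card W) \<le> (?c * (diameter U / r)) ^ m \<and>
      orth_proj V ` U \<subseteq> \<Union>W \<and> (\<forall>B\<in>W. bounded B \<and> diameter B \<le> r)" if U: "U \<in> \<U>" for U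
  proof -
    have sub: "orth_proj V ` U \<subseteq> V" using orth_proj_in[OF V(1)] by auto
    have dist: "dist x y \<le> diameter U" if xy: "x \<in> orth_proj V ` U" "y \<in> orth_proj V ` U" for x y
    proof -
      obtain a b where ab: "a \<in> U" "b \<in> U" "x = orth_proj V a" "y = orth_proj V b" using xy by blast
      have "dist x y = norm (orth_proj V (a - b))"
        using ab by (simp add: dist_norm linear_diff[OF lin])
      also have "\<dots> \<le> norm (a - b)" by (rule norm_orth_proj_le[OF V(1)])
      also have "\<dots> \<le> diameter U"
        using diameter_bounded_bound[OF dU(1)[OF U] ab(1,2)] by (simp add: dist_norm)
      finally show ?thesis .
    qed
    have "\<exists>W. finite W \<and> real (card W) \<le> ((2 * real (dim V) + 3) * (diameter U / r)) ^ dim V \<and>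
      orth_proj V ` U \<subseteq> \<Union>W \<and> (\<forall>B\<in>W. bounded B \<and> diameter B \<le> r)"
      by (rule subspace_set_cover[OF V(1) sub dist r0 dU(2)[OF U]]) blast+
    then show ?thesis unfolding V(2) .
  qed
  then have "\<forall>U\<in>\<U>. \<exists>W. finite W \<and> real (card W) \<le> (?c * (diameter U / r)) ^ m \<and>
      orth_proj V ` U \<subseteq> \<Union>W \<and> (\<forall>B\<in>W. bounded B \<and> diameter B \<le> r)" by (rule ballI)
  from bchoice[OF this] obtain W where W': "\<forall>U\<in>\<U>. finite (W U) \<and>
      real (card (W U)) \<le> (?c * (diameter U / r)) ^ m \<and> orth_proj V ` U \<subseteq> \<Union>(W U) \<and>
      (\<forall>B\<in>W U. bounded B \<and> diameter B \<le> r)" by (elim exE)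
  then have W: "\<And>U. U \<in> \<U> \<Longrightarrow> finite (W U)"
    "\<And>U. U \<in> \<U> \<Longrightarrow> real (card (W U)) \<le> (?c * (diameter U / r)) ^ m"
    "\<And>U. U \<in> \<U> \<Longrightarrow> orth_proj V ` U \<subseteq> \<Union>(W U)"
    "\<And>U. U \<in> \<U> \<Longrightarrow> \<forall>B\<in>W U. bounded B \<and> diameter B \<le> r"
    by simp_all
  have "covering_number (orth_proj V ` F) r \<le> card (\<Union>U\<in>\<U>. W U)"
  proof (rule covering_number_le_card)
    show "finite (\<Union>U\<in>\<U>. W U)" using fin(1) W(1) by blast
    have "F \<subseteq> \<Union>\<U>" using c unfolding intermediate_cover_def by blast
    then show "orth_proj V ` F \<subseteq> \<Union>(\<Union>U\<in>\<U>. W U)"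
    proof (intro subsetI)
      fix y assume "y \<in> orth_proj V ` F"
      with \<open>F \<subseteq> \<Union>\<U>\<close> obtain U where "U \<in> \<U>" "y \<in> orth_proj V ` U" by blast
      then show "y \<in> \<Union>(\<Union>U\<in>\<U>. W U)" using W(3)[of U] by blast
    qed
    show "bounded B \<and> diameter B \<le> r" if "B \<in> (\<Union>U\<in>\<U>. W U)" for B using that W(4) by blast
  qed
  also have "\<dots> \<le> (\<Sum>U\<in>\<U>. card (W U))" by (rule card_UN_le[OF fin(1)])
  finally have "real (covering_number (orth_proj V ` F) r) \<le> real (\<Sum>U\<in>\<U>. card (W U))"
    by (rule of_nat_mono)
  also have "\<dots> = (\<Sum>U\<in>\<U>. real (card (W U)))" by simp
  also have "\<dots> \<le> (\<Sum>U\<in>\<U>. ?c ^ m * r powr (- real m) * \<delta> powr (real m - s) * diameter U powr s)"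
  proof (rule sum_mono)
    fix U assume U: "U \<in> \<U>"
    have D: "0 < diameter U" using dU(2)[OF U] r0 by linarith
    have "real (card (W U)) \<le> (?c * (diameter U / r)) ^ m" by (rule W(2)[OF U])
    also have "\<dots> = ?c ^ m * r powr (- real m) * diameter U powr real m"
      using D r0 by (rule power_ratio)
    also have "diameter U powr real m = diameter U powr (real m - s) * diameter U powr s"
      by (simp add: powr_add[symmetric])
    also have "?c ^ m * r powr (- real m) * (diameter U powr (real m - s) * diameter U powr s)
        \<le> ?c ^ m * r powr (- real m) * (\<delta> powr (real m - s) * diameter U powr s)"
      using dU(3)[OF U] D s by (intro mult_left_mono mult_right_mono powr_mono2) auto
    finally show "real (card (W U)) \<le> ?c ^ m * r powr (- real m) * \<delta> powr (real m - s) * diameter U powr s"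
      by (simp add: mult.assoc)
  qed
  also have "\<dots> = ?c ^ m * r powr (- real m) * \<delta> powr (real m - s) * (\<Sum>U\<in>\<U>. diameter U powr s)"
    by (simp add: sum_distrib_left)
  also have "\<dots> \<le> ?c ^ m * r powr (- real m) * \<delta> powr (real m - s) * 1"
    using fin(2) by (intro mult_left_mono) auto
  also have "\<delta> powr (real m - s) = r powr (\<theta> * (real m - s))"
    using \<theta> \<delta> by (simp add: r_def powr_powr)
  also have "?c ^ m * r powr (- real m) * r powr (\<theta> * (real m - s)) * 1
      = ?c ^ m * r powr (- (real m - \<theta> * (real m - s)))"
    by (simp add: mult.assoc powr_add[symmetric])
  finally show ?thesis .
qed

lemma upper_box_dim_subspace_le:
  fixes F V :: "'a::euclidean_space set"
  assumes V: "subspace V" and F: "bounded F" "F \<noteq> {}" "F \<subseteq> V"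
  shows "upper_box_dim F \<le> ereal (real (dim V))"
proof (rule ereal_le_epsilon2)
  fix e :: real assume e: "0 < e"
  define D where "D = max 1 (diameter F)"
  let ?C = "((2 * real (dim V) + 3) * D) ^ dim V"
  have C: "0 < ?C" by (simp add: D_def max_def)
  have "\<forall>\<^sub>F \<delta> in at_right (0::real). \<delta> \<in> {0<..<1}" by (rule eventually_at_right_real) simp
  then have "\<forall>\<^sub>F \<delta> in at_right 0. real (covering_number F \<delta>) \<le> ?C * \<delta> powr (- real (dim V))"
  proof eventually_elim
    case (elim \<delta>)
    have d: "dist x y \<le> D" if "x \<in> F" "y \<in> F" for x y
      using diameter_bounded_bound[OF F(1) that] by (simp add: D_def)
    have \<delta>: "0 < \<delta>" "\<delta> \<le> D" using elim by (auto simp: D_def)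
    obtain \<U> where U: "finite \<U>" "real (card \<U>) \<le> ((2 * real (dim V) + 3) * (D / \<delta>)) ^ dim V"
      "F \<subseteq> \<Union>\<U>" "\<forall>U\<in>\<U>. bounded U \<and> diameter U \<le> \<delta>"
      by (rule subspace_set_cover[OF V F(3) d \<delta>])
    have "covering_number F \<delta> \<le> card \<U>" using U(4) by (intro covering_number_le_card U(1,3)) auto
    then have "real (covering_number F \<delta>) \<le> ((2 * real (dim V) + 3) * (D / \<delta>)) ^ dim V"
      using U(2) by linarith
    also have "\<dots> = ?C * \<delta> powr (- real (dim V))"
      using power_ratio[of D \<delta> "2 * real (dim V) + 3" "dim V"] \<delta>
      unfolding power_mult_distrib by (simp add: powr_realpow)
    finally show ?case .
  qed
  then have "upper_box_dim F \<le> ereal (real (dim V) + e)"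
    using e by (intro upper_box_dim_leI[OF F(1,2) C]) auto
  then show "upper_box_dim F \<le> ereal (real (dim V)) + ereal e" by simp
qed

section \<open>Monotonicity of the intermediate dimensions\<close>

text \<open>
  Decreasing \<open>\<theta>\<close> lowers the threshold \<open>\<delta> powr (1 / \<theta>)\<close>, provided that \<open>\<delta> \<le> 1\<close>.
\<close>
lemma intermediate_cover_antimono:
  assumes "0 < \<theta>" "\<theta> \<le> \<theta>'" "0 < \<delta>" "\<delta> \<le> 1" "intermediate_cover \<theta>' s \<epsilon> \<delta> F \<U>"
  shows "intermediate_cover \<theta> s \<epsilon> \<delta> F \<U>"
proof -
  have "\<delta> powr (1 / \<theta>) \<le> \<delta> powr (1 / \<theta>')"
    using assms by (intro powr_mono') (auto simp: frac_le)
  then show ?thesis using assms(5) unfolding intermediate_cover_def by force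
qed

lemma lower_intermediate_dim_mono:
  assumes "0 < \<theta>" "\<theta> \<le> \<theta>'"
  shows "lower_intermediate_dim \<theta> F \<le> lower_intermediate_dim \<theta>' F"
proof -
  define Q where "Q \<theta> s \<longleftrightarrow> (\<forall>\<epsilon>>0. \<forall>\<delta>\<^sub>0>0. \<exists>\<delta>. 0 < \<delta> \<and> \<delta> \<le> \<delta>\<^sub>0 \<and>
    (\<exists>\<U>. intermediate_cover \<theta> s \<epsilon> \<delta> F \<U>))" for \<theta> s
  have imp: "Q \<theta> s" if "Q \<theta>' s" for s
  proof -
    from that have s: "\<forall>\<epsilon>>0. \<forall>\<delta>\<^sub>0>0. \<exists>\<delta>>0. \<delta> \<le> \<delta>\<^sub>0 \<and> (\<exists>\<U>. intermediate_cover \<theta>' s \<epsilon> \<delta> F \<U>)"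
      unfolding Q_def .
    show ?thesis unfolding Q_def
    proof (intro allI impI)
      fix \<epsilon> \<delta>\<^sub>0 :: real assume pos: "0 < \<epsilon>" "0 < \<delta>\<^sub>0"
      have "0 < min \<delta>\<^sub>0 1" using pos by simp
      with s pos(1) obtain \<delta> \<U> where "0 < \<delta>" "\<delta> \<le> min \<delta>\<^sub>0 1" "intermediate_cover \<theta>' s \<epsilon> \<delta> F \<U>"
        by blast
      then show "\<exists>\<delta>>0. \<delta> \<le> \<delta>\<^sub>0 \<and> (\<exists>\<U>. intermediate_cover \<theta> s \<epsilon> \<delta> F \<U>)"
        using intermediate_cover_antimono[OF assms, of \<delta> s \<epsilon> F \<U>] by auto
    qed
  qed
  then show ?thesis unfolding lower_intermediate_dim_def Q_def[symmetric]
    by (intro Inf_superset_mono) blast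
qed

lemma upper_intermediate_dim_mono:
  assumes "0 < \<theta>" "\<theta> \<le> \<theta>'"
  shows "upper_intermediate_dim \<theta> F \<le> upper_intermediate_dim \<theta>' F"
proof -
  define Q where "Q \<theta> s \<longleftrightarrow> (\<forall>\<epsilon>>0. \<exists>\<delta>\<^sub>0>0. \<forall>\<delta>. 0 < \<delta> \<and> \<delta> \<le> \<delta>\<^sub>0 \<longrightarrow>
    (\<exists>\<U>. intermediate_cover \<theta> s \<epsilon> \<delta> F \<U>))" for \<theta> s
  have imp: "Q \<theta> s" if "Q \<theta>' s" for s
  proof -
    from that have s: "\<forall>\<epsilon>>0. \<exists>\<delta>\<^sub>0>0. \<forall>\<delta>. 0 < \<delta> \<and> \<delta> \<le> \<delta>\<^sub>0 \<longrightarrow> (\<exists>\<U>. intermediate_cover \<theta>' s \<epsilon> \<delta> F \<U>)"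
      unfolding Q_def .
    show ?thesis unfolding Q_def
    proof (intro allI impI)
      fix \<epsilon> :: real assume "0 < \<epsilon>"
      with s obtain \<delta>\<^sub>0 where \<delta>\<^sub>0: "0 < \<delta>\<^sub>0"
        "\<forall>\<delta>. 0 < \<delta> \<and> \<delta> \<le> \<delta>\<^sub>0 \<longrightarrow> (\<exists>\<U>. intermediate_cover \<theta>' s \<epsilon> \<delta> F \<U>)" by blast
      show "\<exists>\<delta>\<^sub>0>0. \<forall>\<delta>. 0 < \<delta> \<and> \<delta> \<le> \<delta>\<^sub>0 \<longrightarrow> (\<exists>\<U>. intermediate_cover \<theta> s \<epsilon> \<delta> F \<U>)"
      proof (intro exI[of _ "min \<delta>\<^sub>0 1"] conjI allI impI)
        show "0 < min \<delta>\<^sub>0 1" using \<delta>\<^sub>0(1) by simp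
        fix \<delta> assume \<delta>: "0 < \<delta> \<and> \<delta> \<le> min \<delta>\<^sub>0 1"
        then obtain \<U> where "intermediate_cover \<theta>' s \<epsilon> \<delta> F \<U>" using \<delta>\<^sub>0(2) by auto
        then have "intermediate_cover \<theta> s \<epsilon> \<delta> F \<U>"
          using \<delta> by (intro intermediate_cover_antimono[OF assms]) auto
        then show "\<exists>\<U>. intermediate_cover \<theta> s \<epsilon> \<delta> F \<U>" by blast
      qed
    qed
  qed
  then show ?thesis unfolding upper_intermediate_dim_def Q_def[symmetric]
    by (intro Inf_superset_mono) blast
qed

lemma Lim_at_right_0_mono:
  fixes f :: "real \<Rightarrow> ereal"
  assumes mono: "\<And>x y. 0 < x \<Longrightarrow> x \<le> y \<Longrightarrow> f x \<le> f y"
  shows "Lim (at_right 0) f = (INF x\<in>{0<..1}. f x)"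
proof (rule tendsto_Lim)
  show "(f \<longlongrightarrow> (INF x\<in>{0<..1}. f x)) (at_right 0)"
  proof (rule order_tendstoI)
    fix a assume a: "a < (INF x\<in>{0<..1}. f x)"
    have "\<forall>\<^sub>F x in at_right (0::real). x \<in> {0<..<1}" by (rule eventually_at_right_real) simp
    then show "\<forall>\<^sub>F x in at_right 0. a < f x"
    proof eventually_elim
      case (elim x)
      then have "(INF x\<in>{0<..1}. f x) \<le> f x" by (intro INF_lower) auto
      with a show ?case by (rule less_le_trans)
    qed
  next
    fix a assume "(INF x\<in>{0<..1}. f x) < a"
    then obtain y where y: "y \<in> {0<..1}" "f y < a" unfolding INF_less_iff by blast
    have "\<forall>\<^sub>F x in at_right (0::real). x \<in> {0<..<y}" using y(1) by (intro eventually_at_right_real) simp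
    then show "\<forall>\<^sub>F x in at_right 0. f x < a"
    proof eventually_elim
      case (elim x)
      then have "f x \<le> f y" by (intro mono) auto
      then show ?case using y(2) by (rule le_less_trans)
    qed
  qed
qed simp

lemma le_lower_qH_dim_iff: "c \<le> lower_qH_dim F \<longleftrightarrow> (\<forall>\<theta>\<in>{0<..1}. c \<le> lower_intermediate_dim \<theta> F)"
  unfolding lower_qH_dim_def
  by (subst Lim_at_right_0_mono) (auto simp: le_INF_iff lower_intermediate_dim_mono)

lemma le_upper_qH_dim_iff: "c \<le> upper_qH_dim F \<longleftrightarrow> (\<forall>\<theta>\<in>{0<..1}. c \<le> upper_intermediate_dim \<theta> F)"
  unfolding upper_qH_dim_def
  by (subst Lim_at_right_0_mono) (auto simp: le_INF_iff upper_intermediate_dim_mono)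

section \<open>Projections and quasi-Hausdorff dimensions\<close>

lemma lower_box_dim_projection_less:
  fixes E V :: "'a::euclidean_space set"
  assumes V: "subspace V" "dim V = m" and E: "bounded E" "E \<noteq> {}" and \<theta>: "0 < \<theta>"
    and less: "lower_intermediate_dim \<theta> E < ereal (real m)"
  shows "lower_box_dim (orth_proj V ` E) < ereal (real m)"
proof -
  obtain s where s: "0 \<le> s" "s < real m"
    and cov: "\<forall>\<epsilon>>0. \<forall>\<delta>\<^sub>0>0. \<exists>\<delta>. 0 < \<delta> \<and> \<delta> \<le> \<delta>\<^sub>0 \<and> (\<exists>\<U>. intermediate_cover \<theta> s \<epsilon> \<delta> E \<U>)"
    using less unfolding lower_intermediate_dim_def Inf_less_iff by auto
  define t where "t = real m - \<theta> * (real m - s)"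
  have t: "t < real m" using \<theta> s by (simp add: t_def)
  let ?C = "(2 * real m + 3) ^ m"
  have freq: "\<exists>\<^sub>F r in at_right 0. real (covering_number (orth_proj V ` E) r) \<le> ?C * r powr (- t)"
    unfolding frequently_def
  proof
    assume "\<forall>\<^sub>F r in at_right 0. \<not> real (covering_number (orth_proj V ` E) r) \<le> ?C * r powr (- t)"
    then obtain b :: real where b: "0 < b"
      "\<And>r. 0 < r \<Longrightarrow> r < b \<Longrightarrow> \<not> real (covering_number (orth_proj V ` E) r) \<le> ?C * r powr (- t)"
      unfolding eventually_at_right_field by auto
    have "0 < (b / 2) powr \<theta>" using b(1) by simp
    from cov[rule_format, OF zero_less_one this] obtain \<delta> \<U>
      where \<delta>: "0 < \<delta>" "\<delta> \<le> (b / 2) powr \<theta>" "intermediate_cover \<theta> s 1 \<delta> E \<U>"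
      by (elim exE conjE)
    have "\<delta> powr (1 / \<theta>) \<le> ((b / 2) powr \<theta>) powr (1 / \<theta>)"
      using \<delta> \<theta> by (intro powr_mono2) auto
    also have "\<dots> < b" using \<theta> b(1) by (simp add: powr_powr)
    finally have "\<delta> powr (1 / \<theta>) < b" .
    moreover have "0 < \<delta> powr (1 / \<theta>)" using \<delta>(1) by simp
    ultimately show False
      using b(2) covering_number_projection_le[OF V \<delta>(1) \<theta> s(1) _ \<delta>(3)] s(2) unfolding t_def by simp
  qed
  have bE: "bounded (orth_proj V ` E)"
    using V(1) E(1) by (rule bounded_orth_proj_image)
  have neE: "orth_proj V ` E \<noteq> {}" using E(2) by simp
  have C0: "0 < ?C" by simp
  have "t < (t + real m) / 2" using t by simp
  from lower_box_dim_leI[OF bE neE C0 this freq]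
  have "lower_box_dim (orth_proj V ` E) \<le> ereal ((t + real m) / 2)" .
  also have "\<dots> < ereal (real m)" using t by simp
  finally show ?thesis .
qed

lemma upper_box_dim_projection_less:
  fixes E V :: "'a::euclidean_space set"
  assumes V: "subspace V" "dim V = m" and E: "bounded E" "E \<noteq> {}" and \<theta>: "0 < \<theta>"
    and less: "upper_intermediate_dim \<theta> E < ereal (real m)"
  shows "upper_box_dim (orth_proj V ` E) < ereal (real m)"
proof -
  obtain s where s: "0 \<le> s" "s < real m"
    and cov: "\<forall>\<epsilon>>0. \<exists>\<delta>\<^sub>0>0. \<forall>\<delta>. 0 < \<delta> \<and> \<delta> \<le> \<delta>\<^sub>0 \<longrightarrow> (\<exists>\<U>. intermediate_cover \<theta> s \<epsilon> \<delta> E \<U>)"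
    using less unfolding upper_intermediate_dim_def Inf_less_iff by auto
  from cov[rule_format, OF zero_less_one] obtain \<delta>\<^sub>0 where \<delta>\<^sub>0: "0 < \<delta>\<^sub>0"
    and cov1: "\<forall>\<delta>. 0 < \<delta> \<and> \<delta> \<le> \<delta>\<^sub>0 \<longrightarrow> (\<exists>\<U>. intermediate_cover \<theta> s 1 \<delta> E \<U>)"
    by (elim exE conjE)
  define t where "t = real m - \<theta> * (real m - s)"
  have t: "t < real m" using \<theta> s by (simp add: t_def)
  let ?C = "(2 * real m + 3) ^ m"
  have ev: "\<forall>\<^sub>F r in at_right 0. real (covering_number (orth_proj V ` E) r) \<le> ?C * r powr (- t)"
  proof (rule eventually_at_rightI)
    show "0 < \<delta>\<^sub>0 powr (1 / \<theta>)" using \<delta>\<^sub>0 by simp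
    fix r assume "r \<in> {0<..<\<delta>\<^sub>0 powr (1 / \<theta>)}"
    then have r: "0 < r" "r \<le> \<delta>\<^sub>0 powr (1 / \<theta>)" by auto
    have "r powr \<theta> \<le> (\<delta>\<^sub>0 powr (1 / \<theta>)) powr \<theta>" using r \<theta> by (intro powr_mono2) auto
    also have "\<dots> = \<delta>\<^sub>0" using \<theta> \<delta>\<^sub>0 by (simp add: powr_powr)
    finally have le: "r powr \<theta> \<le> \<delta>\<^sub>0" .
    have pos: "0 < r powr \<theta>" using r(1) by simp
    obtain \<U> where U: "intermediate_cover \<theta> s 1 (r powr \<theta>) E \<U>" using cov1 pos le by blast
    have "(r powr \<theta>) powr (1 / \<theta>) = r" using r(1) \<theta> by (simp add: powr_powr)
    then show "real (covering_number (orth_proj V ` E) r) \<le> ?C * r powr (- t)"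
      using covering_number_projection_le[OF V pos \<theta> s(1) _ U] s(2) unfolding t_def by simp
  qed
  have bE: "bounded (orth_proj V ` E)"
    using V(1) E(1) by (rule bounded_orth_proj_image)
  have neE: "orth_proj V ` E \<noteq> {}" using E(2) by simp
  have C0: "0 < ?C" by simp
  have "t < (t + real m) / 2" using t by simp
  from upper_box_dim_leI[OF bE neE C0 this ev]
  have "upper_box_dim (orth_proj V ` E) \<le> ereal ((t + real m) / 2)" .
  also have "\<dots> < ereal (real m)" using t by simp
  finally show ?thesis .
qed

text \<open>
  With \<open>d = m - u\<close>, the three losses \<open>m - s\<close>, \<open>\<theta> * m\<close> and \<open>\<eta>\<close> are each set to \<open>d / 4\<close>.
\<close>
lemma exponent_choice:
  fixes m u :: real
  assumes "0 \<le> u" "u < m"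
  obtains s \<theta> \<eta> where "0 \<le> s" "s < m" "0 < \<theta>" "\<theta> \<le> 1" "0 < \<eta>" "u < (1 - \<theta>) * s - \<eta>"
proof (rule that)
  let ?d = "m - u"
  have d: "0 < ?d" "?d \<le> m" "0 < m" using assms by auto
  show "0 \<le> m - ?d / 4" "m - ?d / 4 < m" "0 < ?d / (4 * m)" "?d / (4 * m) \<le> 1" "0 < ?d / 4"
    using d by (auto simp: field_simps)
  have "(1 - ?d / (4 * m)) * (m - ?d / 4) - ?d / 4 = m - 3 * (?d / 4) + ?d / (4 * m) * (?d / 4)"
    using d by (simp add: field_simps)
  moreover have "0 < ?d / (4 * m) * (?d / 4)" using d by (intro mult_pos_pos divide_pos_pos) auto
  ultimately show "u < (1 - ?d / (4 * m)) * (m - ?d / 4) - ?d / 4" using d by argo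
qed

lemma AE_lower_box_dim_projection_ge:
  fixes \<gamma> :: "(real ^ 'd) set measure" and E :: "(real ^ 'd) set"
  assumes \<gamma>: "grassmannian_haar m \<gamma>" and E: "bounded E" "E \<noteq> {}"
    and u: "0 \<le> u" "u < real m"
    and dim: "\<And>\<theta>. 0 < \<theta> \<Longrightarrow> \<theta> \<le> 1 \<Longrightarrow> ereal (real m) \<le> lower_intermediate_dim \<theta> E"
  shows "AE V in \<gamma>. ereal u \<le> lower_box_dim (orth_proj V ` E)"
proof -
  obtain s \<theta> \<eta> where p: "0 \<le> s" "s < real m" "0 < \<theta>" "\<theta> \<le> 1" "0 < \<eta>" "u < (1 - \<theta>) * s - \<eta>"
    by (rule exponent_choice[OF u])
  have "\<not> (\<forall>\<epsilon>>0. \<forall>\<delta>\<^sub>0>0. \<exists>\<delta>. 0 < \<delta> \<and> \<delta> \<le> \<delta>\<^sub>0 \<and> (\<exists>\<U>. intermediate_cover \<theta> s \<epsilon> \<delta> E \<U>))"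
  proof
    assume "\<forall>\<epsilon>>0. \<forall>\<delta>\<^sub>0>0. \<exists>\<delta>. 0 < \<delta> \<and> \<delta> \<le> \<delta>\<^sub>0 \<and> (\<exists>\<U>. intermediate_cover \<theta> s \<epsilon> \<delta> E \<U>)"
    then have "lower_intermediate_dim \<theta> E \<le> ereal s"
      unfolding lower_intermediate_dim_def using p(1) by (intro Inf_lower) blast
    then have "ereal (real m) \<le> ereal s" using dim[OF p(3,4)] by (rule order_trans[rotated])
    then show False using p(2) by simp
  qed
  then obtain \<epsilon> \<delta>\<^sub>0 where \<epsilon>: "0 < \<epsilon>" and \<delta>\<^sub>0: "0 < \<delta>\<^sub>0"
    "\<And>\<delta>. 0 < \<delta> \<Longrightarrow> \<delta> \<le> \<delta>\<^sub>0 \<Longrightarrow> \<nexists>\<U>. intermediate_cover \<theta> s \<epsilon> \<delta> E \<U>"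
    by auto
  have q: "((1/2) ^ k) powr \<theta> = ((1/2) powr \<theta>) ^ k" for k :: nat
    by (simp add: powr_realpow[symmetric] powr_powr mult.commute)
  have "(\<lambda>k. ((1/2::real) powr \<theta>) ^ k) \<longlonglongrightarrow> 0"
    using p(3) powr_less_mono'[of "1/2" 0 \<theta>] by (intro LIMSEQ_realpow_zero) auto
  then have "\<forall>\<^sub>F k in sequentially. ((1/2::real) powr \<theta>) ^ k < \<delta>\<^sub>0"
    using \<delta>\<^sub>0(1) by (rule order_tendstoD)
  then have no: "\<forall>\<^sub>F k in sequentially. \<nexists>\<U>. intermediate_cover \<theta> s \<epsilon> (((1/2) ^ k) powr \<theta>) E \<U>"
    by (rule eventually_mono) (use \<delta>\<^sub>0(2) q in auto)
  have "AE V in \<gamma>. \<forall>\<^sub>F k in sequentially.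
    ((1/2) ^ k) powr (\<eta> - (1 - \<theta>) * s) \<le> real (covering_number (orth_proj V ` E) ((1/2) ^ k))"
    by (rule AE_eventually_covering_number_ge[OF \<gamma> E p(1,2) \<epsilon> p(3,4,5) _ _ no]) auto
  then show ?thesis
  proof (rule AE_mp, intro AE_I2 impI)
    fix V assume V: "V \<in> space \<gamma>" and ev: "\<forall>\<^sub>F k in sequentially.
      ((1/2) ^ k) powr (\<eta> - (1 - \<theta>) * s) \<le> real (covering_number (orth_proj V ` E) ((1/2) ^ k))"
    have bE: "bounded (orth_proj V ` E)"
      using V grassmannian_haarD(3)[OF \<gamma>] E(1)
      by (auto simp: grassmannian_def intro: bounded_orth_proj_image)
    show "ereal u \<le> lower_box_dim (orth_proj V ` E)"
      by (rule lower_box_dim_geI[OF bE _ u(1) p(6)]) (use E(2) ev in auto)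
  qed
qed

text \<open>
  Economical covers are now missing only at some scales \<open>\<delta> k\<close>. They can be chosen as sparse as
  the Borel-Cantelli argument requires, since large covering numbers along any sequence of
  scales tending to zero bound the upper box dimension from below.
\<close>
lemma AE_upper_box_dim_projection_ge:
  fixes \<gamma> :: "(real ^ 'd) set measure" and E :: "(real ^ 'd) set"
  assumes \<gamma>: "grassmannian_haar m \<gamma>" and E: "bounded E" "E \<noteq> {}"
    and u: "0 \<le> u" "u < real m"
    and dim: "\<And>\<theta>. 0 < \<theta> \<Longrightarrow> \<theta> \<le> 1 \<Longrightarrow> ereal (real m) \<le> upper_intermediate_dim \<theta> E"
  shows "AE V in \<gamma>. ereal u \<le> upper_box_dim (orth_proj V ` E)"
proof -
  obtain s \<theta> \<eta> where p: "0 \<le> s" "s < real m" "0 < \<theta>" "\<theta> \<le> 1" "0 < \<eta>" "u < (1 - \<theta>) * s - \<eta>"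
    by (rule exponent_choice[OF u])
  have "\<not> (\<forall>\<epsilon>>0. \<exists>\<delta>\<^sub>0>0. \<forall>\<delta>. 0 < \<delta> \<and> \<delta> \<le> \<delta>\<^sub>0 \<longrightarrow> (\<exists>\<U>. intermediate_cover \<theta> s \<epsilon> \<delta> E \<U>))"
  proof
    assume "\<forall>\<epsilon>>0. \<exists>\<delta>\<^sub>0>0. \<forall>\<delta>. 0 < \<delta> \<and> \<delta> \<le> \<delta>\<^sub>0 \<longrightarrow> (\<exists>\<U>. intermediate_cover \<theta> s \<epsilon> \<delta> E \<U>)"
    then have "upper_intermediate_dim \<theta> E \<le> ereal s"
      unfolding upper_intermediate_dim_def using p(1) by (intro Inf_lower) blast
    then have "ereal (real m) \<le> ereal s" using dim[OF p(3,4)] by (rule order_trans[rotated])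
    then show False using p(2) by simp
  qed
  then obtain \<epsilon> where \<epsilon>: "0 < \<epsilon>"
    and bad: "\<And>\<delta>\<^sub>0. 0 < \<delta>\<^sub>0 \<Longrightarrow> \<exists>\<delta>. 0 < \<delta> \<and> \<delta> \<le> \<delta>\<^sub>0 \<and> (\<nexists>\<U>. intermediate_cover \<theta> s \<epsilon> \<delta> E \<U>)"
    by auto
  have "\<forall>k. \<exists>\<delta>. 0 < \<delta> \<and> \<delta> \<le> (1/2) ^ k \<and> (\<nexists>\<U>. intermediate_cover \<theta> s \<epsilon> \<delta> E \<U>)"
    by (intro allI bad) simp
  from choice[OF this] obtain \<delta> where \<delta>: "\<And>k. 0 < \<delta> k" "\<And>k. \<delta> k \<le> (1/2) ^ k"
    "\<And>k. \<nexists>\<U>. intermediate_cover \<theta> s \<epsilon> (\<delta> k) E \<U>" by auto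
  define \<rho> where "\<rho> k = \<delta> k powr (1 / \<theta>)" for k :: nat
  have \<rho>0: "0 < \<rho> k" for k using \<delta>(1)[of k] by (simp add: \<rho>_def)
  have \<rho>le: "\<rho> k \<le> (1/2) ^ k" for k
  proof -
    have "\<delta> k \<le> 1" using \<delta>(2)[of k] power_le_one[of "1/2::real" k] by simp
    then have "\<delta> k powr (1 / \<theta>) \<le> \<delta> k powr 1"
      using \<delta>(1)[of k] p(3,4) by (intro powr_mono') auto
    then show ?thesis using \<delta>(1,2)[of k] by (simp add: \<rho>_def)
  qed
  have "\<rho> k powr \<theta> = \<delta> k" for k using p(3) \<delta>(1)[of k] by (simp add: \<rho>_def powr_powr)
  then have no: "\<forall>\<^sub>F k in sequentially. \<nexists>\<U>. intermediate_cover \<theta> s \<epsilon> (\<rho> k powr \<theta>) E \<U>"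
    using \<delta>(3) by simp
  have "(\<lambda>k. (1/2::real) ^ k) \<longlonglongrightarrow> 0" by (intro LIMSEQ_realpow_zero) auto
  then have lim: "\<rho> \<longlonglongrightarrow> 0"
    by (rule tendsto_sandwich[OF _ _ tendsto_const, rotated 2])
       (use \<rho>0 \<rho>le in \<open>auto intro!: always_eventually less_imp_le\<close>)
  have "AE V in \<gamma>. \<forall>\<^sub>F k in sequentially.
    \<rho> k powr (\<eta> - (1 - \<theta>) * s) \<le> real (covering_number (orth_proj V ` E) (\<rho> k))"
    by (rule AE_eventually_covering_number_ge[OF \<gamma> E p(1,2) \<epsilon> p(3,4,5) \<rho>0 \<rho>le no])
  then show ?thesis
  proof (rule AE_mp, intro AE_I2 impI)
    fix V assume ev: "\<forall>\<^sub>F k in sequentially.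
      \<rho> k powr (\<eta> - (1 - \<theta>) * s) \<le> real (covering_number (orth_proj V ` E) (\<rho> k))"
    have "ereal ((1 - \<theta>) * s - \<eta>) \<le> upper_box_dim (orth_proj V ` E)"
      by (rule upper_box_dim_geI[OF \<rho>0 lim]) (use ev in simp)
    then show "ereal u \<le> upper_box_dim (orth_proj V ` E)"
      using p(6) by (meson ereal_less_eq(3) less_imp_le order_trans)
  qed
qed

lemma AE_ge_limit:
  assumes m: "0 < m" and ae: "\<And>u. 0 \<le> u \<Longrightarrow> u < m \<Longrightarrow> AE V in M. ereal u \<le> f V"
  shows "AE V in M. ereal m \<le> f V"
proof -
  define a where "a n = m * (1 - 1 / real (Suc n))" for n
  have "AE V in M. \<forall>n. ereal (a n) \<le> f V"
    unfolding AE_all_countable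
  proof
    fix n
    show "AE V in M. ereal (a n) \<le> f V"
      using m by (intro ae) (auto simp: a_def)
  qed
  then show ?thesis
  proof (rule AE_mp, intro AE_I2 impI)
    fix V assume V: "\<forall>n. ereal (a n) \<le> f V"
    have "a \<longlonglongrightarrow> m * (1 - 0)"
      unfolding a_def by (intro tendsto_intros LIMSEQ_Suc[OF lim_1_over_n])
    then have "(\<lambda>n. ereal (a n)) \<longlonglongrightarrow> ereal m" by simp
    then show "ereal m \<le> f V" by (rule LIMSEQ_le_const2) (use V in auto)
  qed
qed

theorem corollary3p4:
  fixes E :: "(real ^ 'd) set" and m :: nat and \<gamma> :: "(real ^ 'd) set measure"
  assumes "compact E" and "E \<noteq> {}"
    and "0 < m" and "m < CARD('d)"
    and "grassmannian_haar m \<gamma>"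
  shows "((AE V in \<gamma>. lower_box_dim (orth_proj V ` E) = ereal (real m)) \<longleftrightarrow>
            ereal (real m) \<le> lower_qH_dim E) \<and>
         ((AE V in \<gamma>. upper_box_dim (orth_proj V ` E) = ereal (real m)) \<longleftrightarrow>
            ereal (real m) \<le> upper_qH_dim E)"
proof -
  note \<gamma> = assms(5)
  note h = grassmannian_haarD[OF \<gamma>]
  interpret prob_space \<gamma> by (rule h)
  have E: "bounded E" "E \<noteq> {}" using assms(1,2) by (auto intro: compact_imp_bounded)
  have m: "0 < real m" using assms(3) by simp
  have V: "subspace V" "dim V = m" if "V \<in> space \<gamma>" for V
    using that h(3) by (auto simp: grassmannian_def)
  have some_V: "\<exists>V\<in>space \<gamma>. P V" if "AE V in \<gamma>. P V" for P
  proof (rule ccontr)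
    assume "\<not> (\<exists>V\<in>space \<gamma>. P V)"
    with that have "AE V in \<gamma>. False" by (auto elim!: AE_mp)
    then show False by (simp add: AE_False emeasure_space_1)
  qed
  have upper_le: "upper_box_dim (orth_proj V ` E) \<le> ereal (real m)" if "V \<in> space \<gamma>" for V
  proof -
    have "bounded (orth_proj V ` E)"
      using V(1)[OF that] E(1) by (rule bounded_orth_proj_image)
    moreover have "orth_proj V ` E \<subseteq> V" using orth_proj_in[OF V(1)[OF that]] by auto
    ultimately show ?thesis
      using upper_box_dim_subspace_le[OF V(1)[OF that], of "orth_proj V ` E"] V(2)[OF that] E(2) by simp
  qed
  have lower: "(AE V in \<gamma>. lower_box_dim (orth_proj V ` E) = ereal (real m)) \<longleftrightarrow>
            ereal (real m) \<le> lower_qH_dim E"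
  proof
    assume "AE V in \<gamma>. lower_box_dim (orth_proj V ` E) = ereal (real m)"
    then obtain V where W: "V \<in> space \<gamma>" "lower_box_dim (orth_proj V ` E) = ereal (real m)"
      using some_V by blast
    show "ereal (real m) \<le> lower_qH_dim E"
      unfolding le_lower_qH_dim_iff
    proof
      fix \<theta> :: real assume "\<theta> \<in> {0<..1}"
      then have \<theta>: "0 < \<theta>" by simp
      show "ereal (real m) \<le> lower_intermediate_dim \<theta> E"
        using lower_box_dim_projection_less[OF V[OF W(1)] E \<theta>] W(2) by (cases rule: linorder_cases) auto
    qed
  next
    assume "ereal (real m) \<le> lower_qH_dim E"
    then have "AE V in \<gamma>. ereal u \<le> lower_box_dim (orth_proj V ` E)" if "0 \<le> u" "u < real m" for u
      using that by (intro AE_lower_box_dim_projection_ge[OF \<gamma> E]) (auto simp: le_lower_qH_dim_iff)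
    from AE_ge_limit[OF m this]
    have "AE V in \<gamma>. ereal (real m) \<le> lower_box_dim (orth_proj V ` E)" .
    then show "AE V in \<gamma>. lower_box_dim (orth_proj V ` E) = ereal (real m)"
    proof (rule AE_mp, intro AE_I2 impI antisym)
      fix V assume "V \<in> space \<gamma>"
      then show "lower_box_dim (orth_proj V ` E) \<le> ereal (real m)"
        using upper_le lower_box_dim_le_upper order_trans by blast
    qed
  qed
  have upper: "(AE V in \<gamma>. upper_box_dim (orth_proj V ` E) = ereal (real m)) \<longleftrightarrow>
            ereal (real m) \<le> upper_qH_dim E"
  proof
    assume "AE V in \<gamma>. upper_box_dim (orth_proj V ` E) = ereal (real m)"
    then obtain V where W: "V \<in> space \<gamma>" "upper_box_dim (orth_proj V ` E) = ereal (real m)"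
      using some_V by blast
    show "ereal (real m) \<le> upper_qH_dim E"
      unfolding le_upper_qH_dim_iff
    proof
      fix \<theta> :: real assume "\<theta> \<in> {0<..1}"
      then have \<theta>: "0 < \<theta>" by simp
      show "ereal (real m) \<le> upper_intermediate_dim \<theta> E"
        using upper_box_dim_projection_less[OF V[OF W(1)] E \<theta>] W(2) by (cases rule: linorder_cases) auto
    qed
  next
    assume "ereal (real m) \<le> upper_qH_dim E"
    then have "AE V in \<gamma>. ereal u \<le> upper_box_dim (orth_proj V ` E)" if "0 \<le> u" "u < real m" for u
      using that by (intro AE_upper_box_dim_projection_ge[OF \<gamma> E]) (auto simp: le_upper_qH_dim_iff)
    from AE_ge_limit[OF m this]
    have "AE V in \<gamma>. ereal (real m) \<le> upper_box_dim (orth_proj V ` E)" .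
    then show "AE V in \<gamma>. upper_box_dim (orth_proj V ` E) = ereal (real m)"
      by (rule AE_mp, intro AE_I2 impI antisym) (use upper_le in auto)
  qed
  from lower upper show ?thesis ..
qed

end
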